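(* Let $n\geq 6$, and let $\mathrm{Bur}_n$ be the kernel of the Burau representation $\rho_n\colon B_n\to \mathrm{GL}_n(\mathbb{Z}[t,t^{-1}])$ of the braid group on $n$ strands. Then the abelian group $H_1(\mathrm{Bur}_n,\mathbb{Z})$ has infinite rank; in particular, $\mathrm{Bur}_n$ has no finite generating set.
   Context: $B_n$ is the braid group on $n$ strands with standard Artin generators $\sigma_1,\dots,\sigma_{n-1}$. It is realized as a subgroup of $\mathrm{Aut}(F_n)$, where $F_n=\langle x_1,\dots,x_n\rangle$ is free of rank $n$: $\sigma_i$ sends $x_i\mapsto x_ix_{i+1}x_i^{-1}$, $x_{i+1}\mapsto x_i$, and fixes the other generators. The (unreduced) Burau representation $\rho_n\colon B_n\to\mathrm{GL}_n(\mathbb{Z}[t,t^{-1}])$ sends $\sigma_i$ to the block matrix $I_{i-1}\oplus\begin{pmatrix}1-t&t\\1&0\end{pmatrix}\oplus I_{n-i-1}$. The Burau kernel is $\mathrm{Bur}_n=\ker\rho_n$. Equivalently, if $K$ is the kernel of the homomorphism $F_n\to\mathbb{Z}$ taking each $x_i$ to $1$, then $\mathrm{Bur}_n=\ker\big(B_n\to\mathrm{Aut}(F_n/[K,K])\big)$. The rank of an abelian group $A$ is $\dim_{\mathbb{Q}}(A\otimes\mathbb{Q})$. *)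

theory Defs
  imports
    "HOL-Algebra.Free_Abelian_Groups"
    "HOL-Algebra.Generated_Groups"
    "Jordan_Normal_Form.VS_Connect"
begin

section \<open>The braid group on \<open>n\<close> strands\<close>

text \<open>\<open>B\<^sub>n\<close> is given by Artin's presentation. A word is a list of letters; the letter
  \<open>(i, True)\<close> stands for \<open>\<sigma>\<^sub>i\<close> and \<open>(i, False)\<close> for its formal inverse, with
  \<open>1 \<le> i \<le> n - 1\<close>.\<close>

type_synonym braid_word = "(nat \<times> bool) list"

definition braid_words :: "nat \<Rightarrow> braid_word set" where
  "braid_words n = lists ({1..<n} \<times> UNIV)"

inductive braid_rel :: "nat \<Rightarrow> braid_word \<Rightarrow> braid_word \<Rightarrow> bool" for n where
  cancel: "i \<in> {1..<n} \<Longrightarrow> braid_rel n [(i, b), (i, \<not> b)] []"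
| commute: "\<lbrakk>i \<in> {1..<n}; j \<in> {1..<n}; i + 2 \<le> j\<rbrakk> \<Longrightarrow>
    braid_rel n [(i, True), (j, True)] [(j, True), (i, True)]"
| braid: "\<lbrakk>i \<in> {1..<n}; i + 1 \<in> {1..<n}\<rbrakk> \<Longrightarrow>
    braid_rel n [(i, True), (i + 1, True), (i, True)] [(i + 1, True), (i, True), (i + 1, True)]"

inductive braid_eq :: "nat \<Rightarrow> braid_word \<Rightarrow> braid_word \<Rightarrow> bool" for n where
  step: "\<lbrakk>u \<in> braid_words n; v \<in> braid_words n; braid_rel n x y\<rbrakk> \<Longrightarrow>
    braid_eq n (u @ x @ v) (u @ y @ v)"
| refl: "w \<in> braid_words n \<Longrightarrow> braid_eq n w w"
| sym: "braid_eq n v w \<Longrightarrow> braid_eq n w v"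
| trans: "\<lbrakk>braid_eq n u v; braid_eq n v w\<rbrakk> \<Longrightarrow> braid_eq n u w"

definition braid_cong :: "nat \<Rightarrow> (braid_word \<times> braid_word) set" where
  "braid_cong n = {(v, w). braid_eq n v w}"

definition braid_group :: "nat \<Rightarrow> braid_word set monoid" where
  "braid_group n =
    \<lparr>carrier = braid_words n // braid_cong n,
     monoid.mult = (\<lambda>A B. \<Union>u\<in>A. \<Union>v\<in>B. braid_cong n `` {u @ v}),
     one = braid_cong n `` {[]}\<rparr>"

definition artin_gen :: "nat \<Rightarrow> nat \<Rightarrow> braid_word set" where
  "artin_gen n i = braid_cong n `` {[(i, True)]}"

lemma braid_words_simps [simp]:
  "[] \<in> braid_words n"
  "(i, b) # w \<in> braid_words n \<longleftrightarrow> 1 \<le> i \<and> i < n \<and> w \<in> braid_words n"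
  "u @ v \<in> braid_words n \<longleftrightarrow> u \<in> braid_words n \<and> v \<in> braid_words n"
  by (auto simp: braid_words_def)

lemma braid_eq_words: "braid_eq n v w \<Longrightarrow> v \<in> braid_words n \<and> w \<in> braid_words n"
  by (induction rule: braid_eq.induct) (auto elim!: braid_rel.cases)

lemma equiv_braid_cong: "equiv (braid_words n) (braid_cong n)"
  unfolding braid_cong_def
  by (rule equivI)
    (auto simp: refl_on_def sym_def trans_def dest: braid_eq_words
      intro: braid_eq.refl braid_eq.sym braid_eq.trans)

lemma braid_eq_append_left:
  assumes "braid_eq n v w" "u \<in> braid_words n" shows "braid_eq n (u @ v) (u @ w)"
  using assms
proof (induction rule: braid_eq.induct)
  case (step u' v x y)
  then show ?case using braid_eq.step[of "u @ u'" n v x y] by simp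
qed (auto intro: braid_eq.refl braid_eq.sym braid_eq.trans)

lemma braid_eq_append_right:
  assumes "braid_eq n v w" "u \<in> braid_words n" shows "braid_eq n (v @ u) (w @ u)"
  using assms
proof (induction rule: braid_eq.induct)
  case (step u' v x y)
  then show ?case using braid_eq.step[of u' n "v @ u" x y] by simp
qed (auto intro: braid_eq.refl braid_eq.sym braid_eq.trans)

lemma braid_eq_append:
  "\<lbrakk>braid_eq n u u'; braid_eq n v v'\<rbrakk> \<Longrightarrow> braid_eq n (u @ v) (u' @ v')"
  by (meson braid_eq.trans braid_eq_append_left braid_eq_append_right braid_eq_words)

lemma braid_class_eqI: "braid_eq n v w \<Longrightarrow> braid_cong n `` {v} = braid_cong n `` {w}"
  by (rule equiv_class_eq[OF equiv_braid_cong]) (simp add: braid_cong_def)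

lemma braid_class_mult:
  assumes "u \<in> braid_words n" "v \<in> braid_words n"
  shows "braid_cong n `` {u} \<otimes>\<^bsub>braid_group n\<^esub> braid_cong n `` {v} = braid_cong n `` {u @ v}"
proof -
  have "(\<Union>x\<in>braid_cong n `` {u}. \<Union>y\<in>braid_cong n `` {v}. braid_cong n `` {x @ y})
      = braid_cong n `` {u @ v}"
  proof (rule UN_equiv_class2[OF equiv_braid_cong equiv_braid_cong _ assms])
    show "congruent2 (braid_cong n) (braid_cong n) (\<lambda>x y. braid_cong n `` {x @ y})"
      unfolding congruent2_def
    proof (clarify, rule braid_class_eqI)
      fix a b a' b' assume "(a, b) \<in> braid_cong n" "(a', b') \<in> braid_cong n"
      then show "braid_eq n (a @ a') (b @ b')" by (simp add: braid_cong_def braid_eq_append)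
    qed
  qed
  then show ?thesis by (simp add: braid_group_def)
qed

lemma braid_class_carrier: "w \<in> braid_words n \<Longrightarrow> braid_cong n `` {w} \<in> carrier (braid_group n)"
  by (simp add: braid_group_def quotientI)

lemma braid_carrierE:
  assumes "A \<in> carrier (braid_group n)"
  obtains w where "w \<in> braid_words n" "A = braid_cong n `` {w}"
  using assms by (auto simp: braid_group_def elim: quotientE)

lemma braid_group_one: "\<one>\<^bsub>braid_group n\<^esub> = braid_cong n `` {[]}"
  by (simp add: braid_group_def)

lemma braid_word_inverse:
  "w \<in> braid_words n \<Longrightarrow> \<exists>v \<in> braid_words n. braid_eq n (v @ w) []"
proof (induction w)
  case Nil
  show ?case by (rule bexI[of _ "[]"]) (simp_all add: braid_eq.refl)
next
  case (Cons a w)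
  obtain i b where a: "a = (i, b)" by force
  from Cons obtain v where v: "v \<in> braid_words n" "braid_eq n (v @ w) []"
    and w: "w \<in> braid_words n" and i: "i \<in> {1..<n}" by (auto simp: a)
  have "braid_eq n (v @ [(i, \<not> b), (i, \<not> \<not> b)] @ w) (v @ [] @ w)"
    by (rule braid_eq.step[OF v(1) w braid_rel.cancel[OF i]])
  then have "braid_eq n ((v @ [(i, \<not> b)]) @ a # w) []"
    using v(2) by (auto simp: a intro: braid_eq.trans)
  then show ?case using v(1) i by (intro bexI[of _ "v @ [(i, \<not> b)]"]) auto
qed

lemma group_braid_group: "group (braid_group n)"
proof (rule groupI)
  fix x y assume "x \<in> carrier (braid_group n)" "y \<in> carrier (braid_group n)"
  then show "x \<otimes>\<^bsub>braid_group n\<^esub> y \<in> carrier (braid_group n)"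
    by (elim braid_carrierE) (simp add: braid_class_mult braid_class_carrier)
next
  show "\<one>\<^bsub>braid_group n\<^esub> \<in> carrier (braid_group n)"
    by (simp add: braid_group_one braid_class_carrier)
next
  fix x y z
  assume "x \<in> carrier (braid_group n)" "y \<in> carrier (braid_group n)" "z \<in> carrier (braid_group n)"
  then show "x \<otimes>\<^bsub>braid_group n\<^esub> y \<otimes>\<^bsub>braid_group n\<^esub> z = x \<otimes>\<^bsub>braid_group n\<^esub> (y \<otimes>\<^bsub>braid_group n\<^esub> z)"
    by (elim braid_carrierE) (simp add: braid_class_mult)
next
  fix x assume "x \<in> carrier (braid_group n)"
  then show "\<one>\<^bsub>braid_group n\<^esub> \<otimes>\<^bsub>braid_group n\<^esub> x = x"
    by (elim braid_carrierE) (simp add: braid_class_mult braid_group_one)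
next
  fix x assume "x \<in> carrier (braid_group n)"
  then obtain w where w: "w \<in> braid_words n" "x = braid_cong n `` {w}" by (rule braid_carrierE)
  obtain v where v: "v \<in> braid_words n" "braid_eq n (v @ w) []"
    using braid_word_inverse[OF w(1)] by blast
  show "\<exists>y\<in>carrier (braid_group n). y \<otimes>\<^bsub>braid_group n\<^esub> x = \<one>\<^bsub>braid_group n\<^esub>"
    using v w by (intro bexI[of _ "braid_cong n `` {v}"])
      (simp_all add: braid_class_mult braid_group_one braid_class_carrier braid_class_eqI)
qed

section \<open>The Burau representation\<close>

text \<open>\<open>\<int>[t, t\<inverse>]\<close> is the group ring of \<open>\<int>\<close>: finitely supported functions from
  exponents to coefficients, with the convolution product.\<close>

type_synonym laurent = "int \<Rightarrow>\<^sub>0 int"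

definition laurent_t :: laurent where
  "laurent_t = Poly_Mapping.single 1 1"

abbreviation GL_laurent :: "nat \<Rightarrow> laurent mat monoid" where
  "GL_laurent n \<equiv> units_of (ring_mat TYPE(laurent) n ())"

definition burau_gen :: "nat \<Rightarrow> nat \<Rightarrow> laurent mat" where
  "burau_gen n i = diag_block_mat
    [1\<^sub>m (i - 1),
     mat_of_rows_list 2 [[1 - laurent_t, laurent_t], [1, 0]],
     1\<^sub>m (n - i - 1)]"

definition burau_letter :: "nat \<Rightarrow> nat \<times> bool \<Rightarrow> laurent mat" where
  "burau_letter n = (\<lambda>(i, b). if b then burau_gen n i else inv\<^bsub>GL_laurent n\<^esub> (burau_gen n i))"

primrec burau_word :: "nat \<Rightarrow> braid_word \<Rightarrow> laurent mat" where
  "burau_word n [] = 1\<^sub>m n"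
| "burau_word n (l # w) = burau_letter n l * burau_word n w"

text \<open>By \<open>burau_word_cong\<close> below, \<open>burau_word n\<close> is constant on each class, so
  \<^const>\<open>the_elem\<close> picks its unique value.\<close>

definition burau :: "nat \<Rightarrow> braid_word set \<Rightarrow> laurent mat" where
  "burau n A = the_elem (burau_word n ` A)"

definition Bur :: "nat \<Rightarrow> braid_word set monoid" where
  "Bur n = (braid_group n)\<lparr>carrier := kernel (braid_group n) (GL_laurent n) (burau n)\<rparr>"

context
  fixes n i :: nat and a b c d :: laurent and M :: "laurent mat"
  assumes i: "1 \<le> i" "i < n"
    and M: "M = diag_block_mat [1\<^sub>m (i - 1), mat_of_rows_list 2 [[a, b], [c, d]], 1\<^sub>m (n - i - 1)]"
begin

lemma block_dim: "M \<in> carrier_mat n n"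
  using i by (intro carrier_matI) (simp_all add: M dim_diag_block_mat mat_of_rows_list_def)

lemma block_index:
  assumes "r < n" "s < n"
  shows "M $$ (r, s) =
    (if r = i - 1 then (if s = i - 1 then a else if s = i then b else 0)
     else if r = i then (if s = i - 1 then c else if s = i then d else 0)
     else if r = s then 1 else 0)"
proof -
  obtain k where k: "i = Suc k" using i by (cases i) auto
  obtain m where m: "n = k + 2 + m" using i k by (metis Suc_eq_plus1 add_2_eq_Suc' add_Suc_right less_iff_Suc_add add_Suc)
  define P where "P = mat_of_rows_list 2 [[a, b], [c, d]]"
  have P: "dim_row P = 2" "dim_col P = 2"
    "P $$ (0, 0) = a" "P $$ (0, Suc 0) = b" "P $$ (Suc 0, 0) = c" "P $$ (Suc 0, Suc 0) = d"
    by (simp_all add: P_def mat_of_rows_list_def)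
  define D where "D = diag_block_mat [P, 1\<^sub>m m]"
  have D_dim: "dim_row D = 2 + m" "dim_col D = 2 + m"
    by (simp_all add: D_def dim_diag_block_mat P)
  have D: "D $$ (p, q) = (if p < 2 \<and> q < 2 then P $$ (p, q) else if p = q then 1 else 0)"
    if "p < 2 + m" "q < 2 + m" for p q
    using that by (auto simp: D_def P Let_def)
  have M': "M = four_block_mat (1\<^sub>m k) (0\<^sub>m k (2 + m)) (0\<^sub>m (2 + m) k) D"
    using D_dim by (simp add: M k m P_def[symmetric] D_def Let_def)
  have E: "M $$ (r, s) = (if r < k \<or> s < k then (if r = s then 1 else 0) else D $$ (r - k, s - k))"
    if "r < n" "s < n" for r s
    using that D_dim by (auto simp: M' m)
  have pos: "r < k \<or> r = k \<or> r = Suc k \<or> (\<exists>x. r = k + 2 + x)" for r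
    by presburger
  show ?thesis
    using pos[of r] pos[of s] assms
    by (elim disjE exE) (simp_all add: E D P k m)
qed

lemma block_mult_index:
  assumes B: "B \<in> carrier_mat n n" and rs: "r < n" "s < n"
  shows "(M * B) $$ (r, s) =
    (if r = i - 1 then a * B $$ (i - 1, s) + b * B $$ (i, s)
     else if r = i then c * B $$ (i - 1, s) + d * B $$ (i, s)
     else B $$ (r, s))"
proof -
  have sum: "(M * B) $$ (r, s) = (\<Sum>k\<in>{0..<n}. M $$ (r, k) * B $$ (k, s))"
    using B block_dim rs by (simp add: scalar_prod_def)
  show ?thesis
  proof (cases "r = i - 1 \<or> r = i")
    case True
    then have "M $$ (r, k) * B $$ (k, s) = 0" if "k \<in> {0..<n} - {i - 1, i}" for k
      using that rs by (auto simp: block_index)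
    then have "(M * B) $$ (r, s) = (\<Sum>k\<in>{i - 1, i}. M $$ (r, k) * B $$ (k, s))"
      unfolding sum using i by (intro sum.mono_neutral_right) auto
    moreover have "i - 1 \<noteq> i" "i - 1 < n" using i by auto
    ultimately show ?thesis using True rs i(2) by (elim disjE) (simp_all add: block_index)
  next
    case False
    then have "M $$ (r, k) * B $$ (k, s) = 0" if "k \<in> {0..<n} - {r}" for k
      using that rs by (simp add: block_index)
    then have "(M * B) $$ (r, s) = (\<Sum>k\<in>{r}. M $$ (r, k) * B $$ (k, s))"
      unfolding sum using rs by (intro sum.mono_neutral_right) auto
    then show ?thesis using False rs by (simp add: block_index)
  qed
qed

end

lemma laurent_t_inverse: "laurent_t * Poly_Mapping.single (- 1) 1 = 1"
  by (simp add: laurent_t_def mult_single)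

lemma burau_gen_carrier: "\<lbrakk>1 \<le> i; i < n\<rbrakk> \<Longrightarrow> burau_gen n i \<in> carrier_mat n n"
  by (rule block_dim[OF _ _ burau_gen_def])

lemmas burau_gen_index = block_index[OF _ _ burau_gen_def]
lemmas burau_gen_mult_index = block_mult_index[OF _ _ burau_gen_def]

lemma burau_gen_GL:
  assumes i: "1 \<le> i" "i < n" shows "burau_gen n i \<in> carrier (GL_laurent n)"
proof -
  define s :: laurent where "s = Poly_Mapping.single (- 1) 1"
  have ts: "laurent_t * s = 1" "s * laurent_t = 1"
    using laurent_t_inverse by (simp_all add: s_def mult.commute)
  define N where "N = diag_block_mat
    [1\<^sub>m (i - 1), mat_of_rows_list 2 [[0, 1], [s, 1 - s]], 1\<^sub>m (n - i - 1)]"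
  note Nd = block_dim[OF i N_def] and Ni = block_index[OF i N_def]
    and Nm = block_mult_index[OF i N_def]
  note Md = burau_gen_carrier[OF i]
  have "burau_gen n i * N = 1\<^sub>m n"
    by (rule eq_matI)
      (use i Nd Md ts in \<open>auto simp: burau_gen_mult_index Ni algebra_simps simp del: index_mult_mat(1)\<close>)
  moreover have "N * burau_gen n i = 1\<^sub>m n"
    by (rule eq_matI)
      (use i Nd Md ts in \<open>auto simp: Nm burau_gen_index algebra_simps simp del: index_mult_mat(1)\<close>)
  ultimately show ?thesis
    using Nd Md by (auto simp: units_of_carrier Units_def ring_mat_simps)
qed

lemma group_GL_laurent: "group (GL_laurent n)"
proof -
  interpret ring "ring_mat TYPE(laurent) n ()" by (rule ring_mat)
  show ?thesis by (rule units_group)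
qed

lemma GL_laurent_simps [simp]:
  "A \<otimes>\<^bsub>GL_laurent n\<^esub> B = A * B" "\<one>\<^bsub>GL_laurent n\<^esub> = 1\<^sub>m n"
  by (simp_all add: units_of_mult units_of_one ring_mat_simps)

lemma GL_laurent_carrier_mat: "A \<in> carrier (GL_laurent n) \<Longrightarrow> A \<in> carrier_mat n n"
  by (auto simp: units_of_carrier Units_def ring_mat_simps)

lemma burau_letter_GL: "\<lbrakk>1 \<le> i; i < n\<rbrakk> \<Longrightarrow> burau_letter n (i, b) \<in> carrier (GL_laurent n)"
  by (simp add: burau_letter_def burau_gen_GL group.inv_closed[OF group_GL_laurent])

lemma burau_word_GL: "w \<in> braid_words n \<Longrightarrow> burau_word n w \<in> carrier (GL_laurent n)"
proof (induction w)
  case Nil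
  then show ?case
    using monoid.one_closed[OF group.is_monoid[OF group_GL_laurent[of n]]] by simp
next
  case (Cons l w)
  then show ?case
    using monoid.m_closed[OF group.is_monoid[OF group_GL_laurent[of n]]
        burau_letter_GL[of "fst l" n "snd l"], of "burau_word n w"]
    by (cases l) simp
qed

lemma burau_word_append:
  assumes "u \<in> braid_words n" "v \<in> braid_words n"
  shows "burau_word n (u @ v) = burau_word n u * burau_word n v"
  using assms(1)
proof (induction u)
  case Nil
  then show ?case
    using GL_laurent_carrier_mat[OF burau_word_GL[OF assms(2)]] by simp
next
  case (Cons l u)
  obtain i b where l: "l = (i, b)" by force
  from Cons show ?case
    using GL_laurent_carrier_mat[OF burau_word_GL[OF assms(2)]]
      GL_laurent_carrier_mat[OF burau_word_GL[of u n]]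
      GL_laurent_carrier_mat[OF burau_letter_GL[of i n b]]
    by (simp add: l assoc_mult_mat[of _ n n _ n _ n])
qed

lemma burau_word_rel:
  assumes "braid_rel n x y" shows "burau_word n x = burau_word n y"
  using assms
proof cases
  case (cancel i b)
  then have g: "burau_gen n i \<in> carrier (GL_laurent n)" by (auto intro: burau_gen_GL)
  interpret G: group "GL_laurent n" by (rule group_GL_laurent)
  have inv: "inv\<^bsub>GL_laurent n\<^esub> (burau_gen n i) \<in> carrier_mat n n"
    by (rule GL_laurent_carrier_mat[OF G.inv_closed[OF g]])
  show ?thesis
    using cancel G.l_inv[OF g] G.r_inv[OF g] GL_laurent_carrier_mat[OF g] inv
    by (cases b) (simp_all add: burau_letter_def)
next
  case (commute i j)
  then have c: "burau_gen n i \<in> carrier_mat n n" "burau_gen n j \<in> carrier_mat n n"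
    by (auto intro: burau_gen_carrier)
  have "burau_gen n i * burau_gen n j = burau_gen n j * burau_gen n i"
    (is "?L = ?R")
  proof (rule eq_matI)
    obtain k where k: "i = Suc k" using commute by (cases i) auto
    obtain m where m: "j = k + 3 + m" using commute k by (auto simp: nat_le_iff_add)
    fix r s assume "r < dim_row ?R" "s < dim_col ?R"
    then have rs: "r < n" "s < n" using c by auto
    have "r = k \<or> r = k + 1 \<or> r = k + 2 + m \<or> r = k + 3 + m
      \<or> r \<noteq> k \<and> r \<noteq> k + 1 \<and> r \<noteq> k + 2 + m \<and> r \<noteq> k + 3 + m" by blast
    then show "?L $$ (r, s) = ?R $$ (r, s)"
      using rs commute c
      by (elim disjE) (simp_all add: k m burau_gen_mult_index burau_gen_index del: index_mult_mat(1))
  qed (use c in auto)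
  then show ?thesis using commute c by (simp add: burau_letter_def)
next
  case (braid i)
  then have c: "burau_gen n i \<in> carrier_mat n n" "burau_gen n (i + 1) \<in> carrier_mat n n"
    by (auto intro!: burau_gen_carrier)
  have "burau_gen n i * (burau_gen n (i + 1) * burau_gen n i)
      = burau_gen n (i + 1) * (burau_gen n i * burau_gen n (i + 1))"
    (is "?L = ?R")
  proof (rule eq_matI)
    obtain k where k: "i = Suc k" using braid by (cases i) auto
    fix r s assume "r < dim_row ?R" "s < dim_col ?R"
    then have rs: "r < n" "s < n" using c by auto
    have pos: "x = k \<or> x = k + 1 \<or> x = k + 2 \<or> x \<noteq> k \<and> x \<noteq> k + 1 \<and> x \<noteq> k + 2" for x
      by blast
    show "?L $$ (r, s) = ?R $$ (r, s)"
      using pos[of r] pos[of s] rs braid c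
      by (elim disjE) (simp_all add: k burau_gen_mult_index burau_gen_index algebra_simps
          del: index_mult_mat(1))
  qed (use c in auto)
  then show ?thesis using braid c by (simp add: burau_letter_def)
qed

lemma burau_word_cong: "braid_eq n v w \<Longrightarrow> burau_word n v = burau_word n w"
proof (induction rule: braid_eq.induct)
  case (step u v x y)
  then have "x \<in> braid_words n" "y \<in> braid_words n" by (auto elim!: braid_rel.cases)
  then show ?case using step by (simp add: burau_word_append burau_word_rel)
qed auto

lemma burau_class:
  assumes "w \<in> braid_words n" shows "burau n (braid_cong n `` {w}) = burau_word n w"
proof -
  have "burau_word n ` (braid_cong n `` {w}) = {burau_word n w}"
    using assms burau_word_cong by (auto simp: braid_cong_def intro!: image_eqI[of _ _ w] braid_eq.refl)
  then show ?thesis by (simp add: burau_def)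
qed

lemma burau_artin_gen: "\<lbrakk>1 \<le> i; i < n\<rbrakk> \<Longrightarrow> burau n (artin_gen n i) = burau_gen n i"
  using burau_class[of "[(i, True)]" n] burau_gen_carrier[of i n]
  by (simp add: artin_gen_def burau_letter_def)

lemma burau_hom: "burau n \<in> hom (braid_group n) (GL_laurent n)"
proof (rule homI)
  fix x assume "x \<in> carrier (braid_group n)"
  then show "burau n x \<in> carrier (GL_laurent n)"
    by (elim braid_carrierE) (simp add: burau_class burau_word_GL)
next
  fix x y assume "x \<in> carrier (braid_group n)" "y \<in> carrier (braid_group n)"
  then show "burau n (x \<otimes>\<^bsub>braid_group n\<^esub> y) = burau n x \<otimes>\<^bsub>GL_laurent n\<^esub> burau n y"
    by (elim braid_carrierE) (simp add: braid_class_mult burau_class burau_word_append)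
qed

lemma Bur_subgroup: "subgroup (carrier (Bur n)) (braid_group n)"
proof -
  interpret group_hom "braid_group n" "GL_laurent n" "burau n"
    by (intro group_hom.intro group_hom_axioms.intro group_braid_group group_GL_laurent burau_hom)
  show ?thesis using subgroup_kernel by (simp add: Bur_def)
qed

lemma group_Bur: "group (Bur n)"
  using group.subgroup_imp_group[OF group_braid_group Bur_subgroup[of n]] by (simp add: Bur_def)

section \<open>First homology\<close>

text \<open>For a group \<open>G\<close>, \<open>H\<^sub>1(G, \<int>)\<close> is the abelianization of \<open>G\<close>.\<close>

definition H1 :: "('a, 'b) monoid_scheme \<Rightarrow> 'a set monoid" where
  "H1 G = G Mod derived G (carrier G)"

lemma comm_group_H1: "group G \<Longrightarrow> comm_group (H1 G)"
  unfolding H1_def by (rule group.derived_quot_is_comm_group)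

section \<open>The rank of an abelian group\<close>

text \<open>For an abelian group \<open>A\<close> (written multiplicatively), \<open>A \<otimes> \<rat>\<close> is the free abelian group on
  the symbols \<open>a \<otimes> q\<close>, here the pairs \<open>(a, q)\<close>, modulo biadditivity, with \<open>\<rat>\<close> acting by
  \<open>p (a \<otimes> q) = a \<otimes> p q\<close>.\<close>

abbreviation tensor_free :: "('a, 'b) monoid_scheme \<Rightarrow> ('a \<times> rat \<Rightarrow>\<^sub>0 int) monoid" where
  "tensor_free A \<equiv> free_Abelian_group (carrier A \<times> UNIV)"

definition tensor_rels :: "('a, 'b) monoid_scheme \<Rightarrow> ('a \<times> rat \<Rightarrow>\<^sub>0 int) set" where
  "tensor_rels A =
    {frag_of (a \<otimes>\<^bsub>A\<^esub> b, q) - frag_of (a, q) - frag_of (b, q) | a b q. a \<in> carrier A \<and> b \<in> carrier A}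
    \<union> {frag_of (a, p + q) - frag_of (a, p) - frag_of (a, q) | a p q. a \<in> carrier A}"

definition tensor_null :: "('a, 'b) monoid_scheme \<Rightarrow> ('a \<times> rat \<Rightarrow>\<^sub>0 int) set" where
  "tensor_null A = generate (tensor_free A) (tensor_rels A)"

definition tensor_scale :: "rat \<Rightarrow> ('a \<times> rat \<Rightarrow>\<^sub>0 int) \<Rightarrow> ('a \<times> rat \<Rightarrow>\<^sub>0 int)" where
  "tensor_scale p = frag_extend (\<lambda>(a, q). frag_of (a, p * q))"

text \<open>The ring multiplication and unit of the record play no role in a module.\<close>

definition tensor_rat :: "('a, 'b) monoid_scheme \<Rightarrow> (rat, ('a \<times> rat \<Rightarrow>\<^sub>0 int) set) module" where
  "tensor_rat A =
    \<lparr>carrier = carrier (tensor_free A Mod tensor_null A),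
     monoid.mult = undefined,
     one = undefined,
     zero = \<one>\<^bsub>tensor_free A Mod tensor_null A\<^esub>,
     add = monoid.mult (tensor_free A Mod tensor_null A),
     smult = (\<lambda>p X. \<Union>x\<in>X. tensor_null A #>\<^bsub>tensor_free A\<^esub> tensor_scale p x)\<rparr>"

definition infinite_rank :: "('a, 'b) monoid_scheme \<Rightarrow> bool" where
  "infinite_rank A \<longleftrightarrow> \<not> vectorspace.fin_dim (class_ring :: rat ring) (tensor_rat A)"

lemma tensor_scale_simps:
  "tensor_scale p (frag_of (a, q)) = frag_of (a, p * q)"
  "tensor_scale p 0 = 0"
  "tensor_scale p (x + y) = tensor_scale p x + tensor_scale p y"
  "tensor_scale p (x - y) = tensor_scale p x - tensor_scale p y"
  "tensor_scale p (- x) = - tensor_scale p x"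
  by (simp_all add: tensor_scale_def frag_extend_add frag_extend_diff frag_extend_minus)

lemma tensor_scale_mult: "tensor_scale (p * q) x = tensor_scale p (tensor_scale q x)"
proof -
  have "Poly_Mapping.keys x \<subseteq> UNIV" by simp
  then show ?thesis
    by (induction x rule: frag_induction) (auto simp: tensor_scale_simps mult.assoc)
qed

lemma tensor_scale_one: "tensor_scale 1 x = x"
proof -
  have "Poly_Mapping.keys x \<subseteq> UNIV" by simp
  then show ?thesis
    by (induction x rule: frag_induction) (auto simp: tensor_scale_simps)
qed

lemma tensor_scale_keys:
  "Poly_Mapping.keys x \<subseteq> S \<times> UNIV \<Longrightarrow> Poly_Mapping.keys (tensor_scale p x) \<subseteq> S \<times> UNIV"
  unfolding tensor_scale_def using keys_frag_extend[of "\<lambda>(a, q). frag_of (a, p * q)" x] by force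

context
  fixes A :: "('a, 'b) monoid_scheme" (structure)
  assumes A: "comm_group A"
begin

interpretation A: comm_group A by (rule A)

interpretation F: comm_group "tensor_free A" by (rule abelian_free_Abelian_group)

lemma tensor_rels_carrier: "tensor_rels A \<subseteq> carrier (tensor_free A)"
proof -
  have "frag_of x - frag_of y - frag_of z \<in> carrier (tensor_free A)"
    if "x \<in> carrier A \<times> UNIV" "y \<in> carrier A \<times> UNIV" "z \<in> carrier A \<times> UNIV"
    for x y z :: "'a \<times> rat"
    using that keys_diff[of "frag_of x - frag_of y" "frag_of z"] keys_diff[of "frag_of x" "frag_of y"]
    by (auto simp: keys_frag_of)
  then show ?thesis by (auto simp: tensor_rels_def simp del: carrier_free_Abelian_group_iff)
qed

lemma tensor_null_subgroup: "subgroup (tensor_null A) (tensor_free A)"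
  unfolding tensor_null_def by (rule F.generate_is_subgroup[OF tensor_rels_carrier])

lemma tensor_null_normal: "tensor_null A \<lhd> tensor_free A"
  by (rule F.subgroup_imp_normal[OF tensor_null_subgroup])

interpretation N: normal "tensor_null A" "tensor_free A" by (rule tensor_null_normal)

lemma tensor_null_closed:
  "0 \<in> tensor_null A"
  "\<lbrakk>x \<in> tensor_null A; y \<in> tensor_null A\<rbrakk> \<Longrightarrow> x + y \<in> tensor_null A"
  "x \<in> tensor_null A \<Longrightarrow> - x \<in> tensor_null A"
  "\<lbrakk>x \<in> tensor_null A; y \<in> tensor_null A\<rbrakk> \<Longrightarrow> x - y \<in> tensor_null A"
proof -
  show 0: "0 \<in> tensor_null A" using N.one_closed by simp
  show 1: "x + y \<in> tensor_null A" if "x \<in> tensor_null A" "y \<in> tensor_null A" for x y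
    using N.m_closed[OF that] by simp
  show 2: "- x \<in> tensor_null A" if "x \<in> tensor_null A" for x
    using N.m_inv_closed[OF that] inv_free_Abelian_group[of x "carrier A \<times> UNIV"]
      subsetD[OF N.subset that] by simp
  show "x - y \<in> tensor_null A" if "x \<in> tensor_null A" "y \<in> tensor_null A"
    using 1[OF that(1) 2[OF that(2)]] by simp
qed

lemma tensor_scale_rels: "x \<in> tensor_rels A \<Longrightarrow> tensor_scale p x \<in> tensor_rels A"
  unfolding tensor_rels_def by (fastforce simp: tensor_scale_simps distrib_left)

lemma tensor_scale_null:
  assumes "x \<in> tensor_null A" shows "tensor_scale p x \<in> tensor_null A"
  using assms[unfolded tensor_null_def]
proof (induction rule: generate.induct)
  case one
  then show ?case using tensor_null_closed(1) by (simp add: tensor_scale_simps)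
next
  case (incl h)
  then show ?case unfolding tensor_null_def by (auto intro: generate.incl tensor_scale_rels)
next
  case (inv h)
  then have "tensor_scale p h \<in> tensor_null A"
    unfolding tensor_null_def by (auto intro: generate.incl tensor_scale_rels)
  moreover have "inv\<^bsub>tensor_free A\<^esub> h = - h"
    using inv tensor_rels_carrier by auto
  ultimately show ?case by (simp add: tensor_scale_simps tensor_null_closed)
next
  case (eng h1 h2)
  then show ?case by (simp add: tensor_scale_simps tensor_null_closed)
qed

lemma tensor_coset_eq_iff:
  assumes "x \<in> carrier (tensor_free A)" "y \<in> carrier (tensor_free A)"
  shows "tensor_null A #>\<^bsub>tensor_free A\<^esub> x = tensor_null A #>\<^bsub>tensor_free A\<^esub> y
    \<longleftrightarrow> x - y \<in> tensor_null A"
proof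
  assume "tensor_null A #>\<^bsub>tensor_free A\<^esub> x = tensor_null A #>\<^bsub>tensor_free A\<^esub> y"
  then have "x \<in> tensor_null A #>\<^bsub>tensor_free A\<^esub> y"
    using F.rcos_self[OF assms(1) tensor_null_subgroup] by simp
  then show "x - y \<in> tensor_null A" by (auto simp: r_coset_def)
next
  assume "x - y \<in> tensor_null A"
  then have "x \<in> tensor_null A #>\<^bsub>tensor_free A\<^esub> y"
    by (force simp: r_coset_def)
  then show "tensor_null A #>\<^bsub>tensor_free A\<^esub> x = tensor_null A #>\<^bsub>tensor_free A\<^esub> y"
    using F.repr_independence[OF _ assms(2) tensor_null_subgroup] by simp
qed

lemma tensor_scale_carrier:
  "x \<in> carrier (tensor_free A) \<Longrightarrow> tensor_scale p x \<in> carrier (tensor_free A)"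
  by (simp add: tensor_scale_keys)

lemma tensor_smult_coset:
  assumes "x \<in> carrier (tensor_free A)"
  shows "p \<odot>\<^bsub>tensor_rat A\<^esub> (tensor_null A #>\<^bsub>tensor_free A\<^esub> x)
    = tensor_null A #>\<^bsub>tensor_free A\<^esub> tensor_scale p x"
proof -
  have *: "tensor_null A #>\<^bsub>tensor_free A\<^esub> tensor_scale p y
      = tensor_null A #>\<^bsub>tensor_free A\<^esub> tensor_scale p x"
    if "y \<in> tensor_null A #>\<^bsub>tensor_free A\<^esub> x" for y
  proof -
    have y: "y \<in> carrier (tensor_free A)"
      by (rule subsetD[OF F.r_coset_subset_G[OF N.subset assms] that])
    have "y - x \<in> tensor_null A" using that by (auto simp: r_coset_def)
    then have "tensor_scale p y - tensor_scale p x \<in> tensor_null A"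
      using tensor_scale_null[of "y - x" p] by (simp add: tensor_scale_simps)
    then show ?thesis using tensor_coset_eq_iff y assms tensor_scale_carrier by blast
  qed
  have "(\<Union>y\<in>tensor_null A #>\<^bsub>tensor_free A\<^esub> x. tensor_null A #>\<^bsub>tensor_free A\<^esub> tensor_scale p y)
      = (\<Union>y\<in>tensor_null A #>\<^bsub>tensor_free A\<^esub> x. tensor_null A #>\<^bsub>tensor_free A\<^esub> tensor_scale p x)"
    by (rule SUP_cong[OF HOL.refl *])
  also have "\<dots> = tensor_null A #>\<^bsub>tensor_free A\<^esub> tensor_scale p x"
    using F.rcos_self[OF assms tensor_null_subgroup] by blast
  finally show ?thesis by (simp only: tensor_rat_def module.simps)
qed

lemma tensor_add_coset:
  assumes "x \<in> carrier (tensor_free A)" "y \<in> carrier (tensor_free A)"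
  shows "(tensor_null A #>\<^bsub>tensor_free A\<^esub> x) \<oplus>\<^bsub>tensor_rat A\<^esub> (tensor_null A #>\<^bsub>tensor_free A\<^esub> y)
    = tensor_null A #>\<^bsub>tensor_free A\<^esub> (x + y)"
  using N.rcos_sum[OF assms] by (simp add: tensor_rat_def)

lemma tensor_scale_add_null:
  assumes "x \<in> carrier (tensor_free A)"
  shows "tensor_scale (p + q) x - (tensor_scale p x + tensor_scale q x) \<in> tensor_null A"
proof -
  have "Poly_Mapping.keys x \<subseteq> carrier A \<times> UNIV" using assms by simp
  then show ?thesis
  proof (induction x rule: frag_induction)
    case zero
    show ?case by (simp add: tensor_scale_simps tensor_null_closed)
  next
    case (one x)
    obtain a r where x: "x = (a, r)" "a \<in> carrier A" using one by (cases x) auto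
    have "frag_of (a, p * r + q * r) - frag_of (a, p * r) - frag_of (a, q * r) \<in> tensor_rels A"
      using x(2) unfolding tensor_rels_def by blast
    then have "frag_of (a, p * r + q * r) - frag_of (a, p * r) - frag_of (a, q * r) \<in> tensor_null A"
      unfolding tensor_null_def by (rule generate.incl)
    then show ?case by (simp add: x tensor_scale_simps distrib_right diff_diff_eq)
  next
    case (diff x y)
    from tensor_null_closed(4)[OF diff(1,2)] show ?case
      by (simp add: tensor_scale_simps algebra_simps)
  qed
qed

lemma tensor_carrierE:
  assumes "X \<in> carrier (tensor_rat A)"
  obtains x where "x \<in> carrier (tensor_free A)" "X = tensor_null A #>\<^bsub>tensor_free A\<^esub> x"
  using assms unfolding tensor_rat_def carrier_FactGroup by auto

lemma tensor_carrierI: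
  "x \<in> carrier (tensor_free A) \<Longrightarrow> tensor_null A #>\<^bsub>tensor_free A\<^esub> x \<in> carrier (tensor_rat A)"
  unfolding tensor_rat_def carrier_FactGroup by auto

lemma vectorspace_tensor_rat: "vectorspace (class_ring :: rat ring) (tensor_rat A)"
proof (intro vectorspace.intro Module.module.intro module_axioms.intro)
  show "field (class_ring :: rat ring)" by (rule class_field)
next
  show "cring (class_ring :: rat ring)" by (rule class_cring.cring_axioms)
  interpret Q: comm_group "tensor_free A Mod tensor_null A"
    by (rule F.abelian_FactGroup[OF tensor_null_subgroup])
  have inv: "\<exists>y\<in>carrier (tensor_free A Mod tensor_null A).
      y \<otimes>\<^bsub>tensor_free A Mod tensor_null A\<^esub> x = \<one>\<^bsub>tensor_free A Mod tensor_null A\<^esub>"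
    if "x \<in> carrier (tensor_free A Mod tensor_null A)" for x
    using Q.l_inv[OF that] Q.inv_closed[OF that] by blast
  have "comm_group (add_monoid (tensor_rat A))"
    unfolding tensor_rat_def partial_object.simps monoid.simps ring.simps module.simps
    by (rule comm_groupI; unfold partial_object.simps monoid.simps)
      (rule Q.m_closed Q.one_closed Q.m_assoc Q.m_comm Q.l_one inv; assumption)+
  then show "abelian_group (tensor_rat A)"
    by (simp add: abelian_group_def abelian_group_axioms_def abelian_monoid_def comm_group_def)
next
  fix p :: rat and X assume "X \<in> carrier (tensor_rat A)"
  then show "p \<odot>\<^bsub>tensor_rat A\<^esub> X \<in> carrier (tensor_rat A)"
    by (elim tensor_carrierE)
      (simp only: tensor_smult_coset tensor_scale_carrier tensor_carrierI)
next
  fix p q :: rat and X assume "X \<in> carrier (tensor_rat A)"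
  then obtain x where x: "x \<in> carrier (tensor_free A)" "X = tensor_null A #>\<^bsub>tensor_free A\<^esub> x"
    by (rule tensor_carrierE)
  have "tensor_scale p x + tensor_scale q x \<in> carrier (tensor_free A)"
    using F.m_closed[OF tensor_scale_carrier[OF x(1)] tensor_scale_carrier[OF x(1)]] by simp
  then have "tensor_null A #>\<^bsub>tensor_free A\<^esub> tensor_scale (p + q) x
      = tensor_null A #>\<^bsub>tensor_free A\<^esub> (tensor_scale p x + tensor_scale q x)"
    using tensor_coset_eq_iff tensor_scale_add_null[OF x(1)] tensor_scale_carrier[OF x(1)] by blast
  then have "(p + q) \<odot>\<^bsub>tensor_rat A\<^esub> X = p \<odot>\<^bsub>tensor_rat A\<^esub> X \<oplus>\<^bsub>tensor_rat A\<^esub> q \<odot>\<^bsub>tensor_rat A\<^esub> X"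
    by (simp only: x(2) tensor_smult_coset[OF x(1)]
        tensor_add_coset[OF tensor_scale_carrier[OF x(1)] tensor_scale_carrier[OF x(1)]])
  then show "(p \<oplus>\<^bsub>class_ring\<^esub> q) \<odot>\<^bsub>tensor_rat A\<^esub> X
      = p \<odot>\<^bsub>tensor_rat A\<^esub> X \<oplus>\<^bsub>tensor_rat A\<^esub> q \<odot>\<^bsub>tensor_rat A\<^esub> X" by simp
next
  fix p :: rat and X Y assume "X \<in> carrier (tensor_rat A)" "Y \<in> carrier (tensor_rat A)"
  then obtain x y where x: "x \<in> carrier (tensor_free A)" "X = tensor_null A #>\<^bsub>tensor_free A\<^esub> x"
    and y: "y \<in> carrier (tensor_free A)" "Y = tensor_null A #>\<^bsub>tensor_free A\<^esub> y"
    by (elim tensor_carrierE)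
  have "x + y \<in> carrier (tensor_free A)" using F.m_closed[OF x(1) y(1)] by simp
  then show "p \<odot>\<^bsub>tensor_rat A\<^esub> (X \<oplus>\<^bsub>tensor_rat A\<^esub> Y)
      = p \<odot>\<^bsub>tensor_rat A\<^esub> X \<oplus>\<^bsub>tensor_rat A\<^esub> p \<odot>\<^bsub>tensor_rat A\<^esub> Y"
    by (simp only: x(2) y(2) tensor_add_coset[OF x(1) y(1)] tensor_smult_coset x(1) y(1)
        tensor_scale_carrier tensor_add_coset tensor_scale_simps)
next
  fix p q :: rat and X assume "X \<in> carrier (tensor_rat A)"
  then show "(p \<otimes>\<^bsub>class_ring\<^esub> q) \<odot>\<^bsub>tensor_rat A\<^esub> X = p \<odot>\<^bsub>tensor_rat A\<^esub> (q \<odot>\<^bsub>tensor_rat A\<^esub> X)"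
    by (elim tensor_carrierE)
      (simp add: tensor_smult_coset tensor_scale_carrier tensor_scale_mult
        del: carrier_free_Abelian_group_iff)
next
  fix X assume "X \<in> carrier (tensor_rat A)"
  then show "\<one>\<^bsub>class_ring :: rat ring\<^esub> \<odot>\<^bsub>tensor_rat A\<^esub> X = X"
    by (elim tensor_carrierE)
      (simp add: tensor_smult_coset tensor_scale_one del: carrier_free_Abelian_group_iff)
qed

end

end

theory Submission
  imports Defs
begin

text \<open>
  Braid words act on tuples of elements of a group by the Hurwitz action
  \<open>(\<dots>, X\<^sub>i, X\<^sub>i\<^sub>+\<^sub>1, \<dots>) \<mapsto> (\<dots>, X\<^sub>i X\<^sub>i\<^sub>+\<^sub>1 X\<^sub>i\<inverse>, X\<^sub>i, \<dots>)\<close>, which is how the braid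
  group acts on \<open>Hom(F\<^sub>n, G)\<close>. When the \<open>X\<^sub>i\<close> are affine maps \<open>y \<mapsto> t y + v\<^sub>i\<close>, the vector \<open>v\<close>
  transforms by the Burau matrices. The proof uses instead affine maps
  \<open>y \<mapsto> t (1 + u\<^sub>i \<epsilon>) y + (v\<^sub>i + w\<^sub>i \<epsilon>)\<close> over the dual numbers, \<open>\<epsilon>\<^sup>2 = 0\<close>; the homomorphisms from
  \<open>F\<^sub>n\<close> that they define see the quotient \<open>F\<^sub>n/[K,[K,K]]\<close>, one step beyond the quotient
  \<open>F\<^sub>n/[K,K]\<close> seen by Burau. A braid in the Burau kernel fixes the vectors \<open>u\<close> and \<open>v\<close>, and it translates \<open>w\<close> by a
  vector that depends only on the braid, \<open>u\<close> and \<open>v\<close>. For fixed \<open>u, v\<close> this displacement is a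
  homomorphism from the Burau kernel to the torsion-free abelian group of Laurent vectors: a
  component of a Johnson homomorphism (\<open>johnson_append\<close>).

  With entries numbered from 0, \<open>\<sigma>\<^sub>3\<close> acts on the entries 2 and 3.
  Taking \<open>u\<close> and \<open>v\<close> fixed by \<open>\<sigma>\<^sub>3\<close> and pairing the displacement with the functional
  \<open>w \<mapsto> w\<^sub>2 - w\<^sub>3\<close>, an eigenvector of \<open>\<sigma>\<^sub>3\<close> with eigenvalue \<open>- t\<close>, gives a homomorphism \<open>J\<close> to
  \<open>\<int>[t, t\<inverse>]\<close> with \<open>J(\<sigma>\<^sub>3 g \<sigma>\<^sub>3\<inverse>) = - t J(g)\<close> (\<open>conj_sigma3\<close>). So a single \<open>g\<close> with \<open>J(g) \<noteq> 0\<close>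
  yields the conjugates \<open>\<sigma>\<^sub>3\<^sup>m g \<sigma>\<^sub>3\<^sup>-\<^sup>m\<close>, whose values \<open>(- t)\<^sup>m J(g)\<close> are linearly independent, and
  their degrees are unbounded. The first fact gives infinite rank of \<open>H\<^sub>1\<close>, the second excludes a
  finite generating set.

  The element \<open>g\<close> is a commutator of two half twists, along arcs that cross but whose algebraic
  intersection, a Laurent polynomial, vanishes. Under Burau a half twist is the identity plus a
  map of rank one, and two such maps commute as soon as two pairings vanish
  (\<open>theta_pairing\<close>); this is why \<open>g\<close> lies in the Burau kernel (\<open>arc_commutator_Bur\<close>). The finer
  action tells the arcs apart, and \<open>J(g) = t + t\<^sup>2 - t\<^sup>3 - t\<^sup>4\<close> (\<open>johnson_arc_commutator\<close>). Six
  strands give \<open>g\<close> enough room; for more strands the same word is used.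
\<close>

section \<open>Racks and the Hurwitz action\<close>

text \<open>
  Only conjugation enters the Hurwitz action, so a group can be replaced by a rack: \<open>f p q\<close>
  stands for \<open>p q p\<inverse>\<close> and \<open>g p q\<close> for \<open>p\<inverse> q p\<close>. Words act with their last letter first, in
  accordance with the order of the factors in \<^const>\<open>burau_word\<close>.
\<close>

definition hurwitz_letter ::
  "('a \<Rightarrow> 'a \<Rightarrow> 'a) \<Rightarrow> ('a \<Rightarrow> 'a \<Rightarrow> 'a) \<Rightarrow> nat \<times> bool \<Rightarrow> (nat \<Rightarrow> 'a) \<Rightarrow> nat \<Rightarrow> 'a" where
  "hurwitz_letter f g = (\<lambda>(i, b) x.
    if b then x(i - 1 := f (x (i - 1)) (x i), i := x (i - 1))
    else x(i - 1 := x i, i := g (x i) (x (i - 1))))"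

primrec hurwitz ::
  "('a \<Rightarrow> 'a \<Rightarrow> 'a) \<Rightarrow> ('a \<Rightarrow> 'a \<Rightarrow> 'a) \<Rightarrow> braid_word \<Rightarrow> (nat \<Rightarrow> 'a) \<Rightarrow> nat \<Rightarrow> 'a" where
  "hurwitz f g [] x = x"
| "hurwitz f g (l # w) x = hurwitz_letter f g l (hurwitz f g w x)"

lemma hurwitz_append: "hurwitz f g (v @ w) x = hurwitz f g v (hurwitz f g w x)"
  by (induction v) simp_all

definition inv_word :: "braid_word \<Rightarrow> braid_word" where
  "inv_word w = rev (map (\<lambda>(i, b). (i, \<not> b)) w)"

lemma inv_word_simps [simp]:
  "inv_word [] = []"
  "inv_word (l # w) = inv_word w @ [(fst l, \<not> snd l)]"
  by (simp_all add: inv_word_def case_prod_unfold)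

lemma inv_word_braid_words [simp]: "inv_word w \<in> braid_words n \<longleftrightarrow> w \<in> braid_words n"
  by (induction w) auto

locale rack =
  fixes f g :: "'a \<Rightarrow> 'a \<Rightarrow> 'a"
  assumes act_inv: "f p (g p q) = q"
    and inv_act: "g p (f p q) = q"
    and distrib: "f p (f q r) = f (f p q) (f p r)"
begin

lemma hurwitz_letter_cancel:
  "1 \<le> i \<Longrightarrow> hurwitz_letter f g (i, b) (hurwitz_letter f g (i, \<not> b) x) = x"
  using fun_upd_twist[of i "i - 1"]
  by (cases b) (auto simp: hurwitz_letter_def act_inv inv_act)

lemma hurwitz_rel: "braid_rel n v w \<Longrightarrow> hurwitz f g v x = hurwitz f g w x"
proof (induction rule: braid_rel.induct)
  case (cancel i b)
  then show ?case using hurwitz_letter_cancel by simp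
next
  case (commute i j)
  then have "i - 1 \<noteq> j - 1" "i \<noteq> j - 1" "i - 1 \<noteq> j" "i \<noteq> j" "i - 1 \<noteq> i" "j - 1 \<noteq> j" by auto
  then show ?case
    by (simp add: hurwitz_letter_def fun_upd_twist[of "j - Suc 0" "i - Suc 0"]
        fun_upd_twist[of j "i - Suc 0"] fun_upd_twist[of "j - Suc 0" i] fun_upd_twist[of j i])
next
  case (braid i)
  then obtain k where i: "i = Suc k" by (cases i) auto
  show ?case
  proof
    fix m
    have "m = k \<or> m = Suc k \<or> m = Suc (Suc k) \<or> m \<noteq> k \<and> m \<noteq> Suc k \<and> m \<noteq> Suc (Suc k)"
      by blast
    then show "hurwitz f g [(i, True), (i + 1, True), (i, True)] x m
      = hurwitz f g [(i + 1, True), (i, True), (i + 1, True)] x m"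
      by (elim disjE) (simp_all add: i hurwitz_letter_def distrib[symmetric])
  qed
qed

lemma hurwitz_cong: "braid_eq n v w \<Longrightarrow> hurwitz f g v x = hurwitz f g w x"
proof (induction arbitrary: x rule: braid_eq.induct)
  case (step u v y z)
  then show ?case by (simp add: hurwitz_append hurwitz_rel)
qed simp_all

lemma hurwitz_inv_word:
  "w \<in> braid_words n \<Longrightarrow> hurwitz f g (inv_word w) (hurwitz f g w x) = x"
proof (induction w arbitrary: x)
  case (Cons l w)
  then show ?case
    using hurwitz_letter_cancel[of "fst l" "\<not> snd l"] by (cases l) (simp add: hurwitz_append)
qed simp

end

lemma hurwitz_rack_hom:
  assumes "\<And>p q. h (f p q) = f' (h p) (h q)" "\<And>p q. h (g p q) = g' (h p) (h q)"
  shows "h (hurwitz f g w x k) = hurwitz f' g' w (\<lambda>j. h (x j)) k"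
proof -
  have "(\<lambda>k. h (hurwitz f g w x k)) = hurwitz f' g' w (\<lambda>j. h (x j))"
  proof (induction w)
    case (Cons l w)
    have "(\<lambda>k. h (hurwitz_letter f g l y k)) = hurwitz_letter f' g' l (\<lambda>k. h (y k))" for y
      by (auto simp: hurwitz_letter_def fun_eq_iff assms split: prod.splits)
    then show ?case using Cons by simp
  qed simp
  then show ?thesis by (rule fun_cong)
qed

text \<open>
  For an operation \<open>h\<close> that is a homomorphism from a product of two racks; the naturality above
  is applied to the product and its projections. It yields the linearity of the Burau action and
  the affine behaviour of its extension from one-point identities.
\<close>

lemma hurwitz_pair:
  assumes "\<And>p p' q q'. h (f p q) (f' p' q') = f'' (h p p') (h q q')"
    and "\<And>p p' q q'. h (g p q) (g' p' q') = g'' (h p p') (h q q')"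
  shows "h (hurwitz f g w x k) (hurwitz f' g' w y k) = hurwitz f'' g'' w (\<lambda>j. h (x j) (y j)) k"
proof -
  define F where "F p q = (f (fst p) (fst q), f' (snd p) (snd q))" for p q
  define G where "G p q = (g (fst p) (fst q), g' (snd p) (snd q))" for p q
  define z where "z = hurwitz F G w (\<lambda>j. (x j, y j))"
  have "fst (z k) = hurwitz f g w x k"
    unfolding z_def
    using hurwitz_rack_hom[where h = fst and f = F and g = G and f' = f and g' = g]
    by (simp add: F_def G_def)
  moreover have "snd (z k) = hurwitz f' g' w y k"
    unfolding z_def
    using hurwitz_rack_hom[where h = snd and f = F and g = G and f' = f' and g' = g']
    by (simp add: F_def G_def)
  moreover have "h (fst (z k)) (snd (z k)) = hurwitz f'' g'' w (\<lambda>j. h (x j) (y j)) k"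
    unfolding z_def
    using hurwitz_rack_hom[where h = "\<lambda>p. h (fst p) (snd p)" and f = F and g = G
        and f' = f'' and g' = g'']
    by (simp add: F_def G_def assms)
  ultimately show ?thesis by simp
qed

section \<open>The Alexander rack and the Burau action\<close>

text \<open>The translation part of the conjugate of \<open>y \<mapsto> t y + q\<close> by \<open>y \<mapsto> t y + p\<close>.\<close>

definition alexander :: "'r::comm_ring_1 \<Rightarrow> 'r \<Rightarrow> 'r \<Rightarrow> 'r" where
  "alexander t p q = p + t * (q - p)"

lemma rack_alexander: "t * s = 1 \<Longrightarrow> rack (alexander t) (alexander s)"
proof
  assume ts: "t * s = 1"
  have st: "s * t = 1" using ts by (simp add: mult.commute)
  show "alexander t p (alexander s p q) = q" for p q
    by (simp add: alexander_def mult.assoc[symmetric] ts)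
  show "alexander s p (alexander t p q) = q" for p q
    by (simp add: alexander_def mult.assoc[symmetric] st)
  show "alexander t p (alexander t q r) = alexander t (alexander t p q) (alexander t p r)" for p q r
    by (simp add: alexander_def algebra_simps)
qed

lemma unit_rules:
  fixes t s :: "'r::comm_ring_1"
  assumes "t * s = 1" shows "t * s = 1" "s * t = 1" "t * (s * x) = x" "s * (t * x) = x"
  using assms by (simp_all add: mult.assoc[symmetric] mult.commute)

abbreviation burau_act :: "'r::comm_ring_1 \<Rightarrow> 'r \<Rightarrow> braid_word \<Rightarrow> (nat \<Rightarrow> 'r) \<Rightarrow> nat \<Rightarrow> 'r" where
  "burau_act t s \<equiv> hurwitz (alexander t) (alexander s)"

lemma burau_act_add:
  "burau_act t s w (\<lambda>k. x k + y k) = (\<lambda>k. burau_act t s w x k + burau_act t s w y k)"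
proof
  fix k
  show "burau_act t s w (\<lambda>k. x k + y k) k = burau_act t s w x k + burau_act t s w y k"
    by (rule hurwitz_pair[where h = "\<lambda>a b. a + b", symmetric]) (simp_all add: alexander_def algebra_simps)
qed

lemma burau_act_scale:
  "burau_act t s w (\<lambda>k. c * x k) = (\<lambda>k. c * burau_act t s w x k)"
proof
  fix k
  show "burau_act t s w (\<lambda>k. c * x k) k = c * burau_act t s w x k"
    by (rule hurwitz_rack_hom[symmetric]) (simp_all add: alexander_def algebra_simps)
qed

section \<open>A rack extending the Alexander rack\<close>

text \<open>
  The triple \<open>(a, b, c)\<close> encodes the affine map \<open>y \<mapsto> t (1 + a \<epsilon>) y + (b + c \<epsilon>)\<close> over the dual
  numbers, and \<open>ext t p q\<close> encodes the conjugate of \<open>q\<close> by \<open>p\<close>. The first components are merely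
  permuted, the second ones form the Alexander rack, and the last ones do so up to a cocycle that
  is bilinear in the first and the second components.
\<close>

type_synonym 'r triple = "'r \<times> 'r \<times> 'r"

definition ext :: "'r::comm_ring_1 \<Rightarrow> 'r triple \<Rightarrow> 'r triple \<Rightarrow> 'r triple" where
  "ext t = (\<lambda>(a, b, c) (a', b', c').
    (a', alexander t b b', alexander t c c' + t * (a * b' - a' * b)))"

definition ext_inv :: "'r::comm_ring_1 \<Rightarrow> 'r triple \<Rightarrow> 'r triple \<Rightarrow> 'r triple" where
  "ext_inv s = (\<lambda>(a, b, c) (a', b', c').
    (a', alexander s b b', alexander s c c' - (a * alexander s b b' - a' * b)))"

lemma rack_ext: "t * s = 1 \<Longrightarrow> rack (ext t) (ext_inv s)"
proof
  assume ts: "t * s = 1"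
  show "ext t p (ext_inv s p q) = q" for p q
    by (cases p, cases q) (simp add: ext_def ext_inv_def alexander_def algebra_simps unit_rules[OF ts])
  show "ext_inv s p (ext t p q) = q" for p q
    by (cases p, cases q) (simp add: ext_def ext_inv_def alexander_def algebra_simps unit_rules[OF ts])
  show "ext t p (ext t q r) = ext t (ext t p q) (ext t p r)" for p q r
    by (cases p, cases q, cases r) (simp add: ext_def alexander_def algebra_simps)
qed

abbreviation ext_act :: "'r::comm_ring_1 \<Rightarrow> 'r \<Rightarrow> braid_word \<Rightarrow> (nat \<Rightarrow> 'r triple) \<Rightarrow> nat \<Rightarrow> 'r triple" where
  "ext_act t s \<equiv> hurwitz (ext t) (ext_inv s)"

definition shift :: "(nat \<Rightarrow> 'r triple) \<Rightarrow> (nat \<Rightarrow> 'r::comm_ring_1) \<Rightarrow> nat \<Rightarrow> 'r triple" where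
  "shift x d k = (fst (x k), fst (snd (x k)), snd (snd (x k)) + d k)"

text \<open>
  Changing the last components changes the outcome linearly, through the Burau action. This makes
  the displacement below independent of the starting value of the last components.
\<close>

lemma ext_act_shift: "ext_act t s w (shift x d) = shift (ext_act t s w x) (burau_act t s w d)"
proof
  fix k
  show "ext_act t s w (shift x d) k = shift (ext_act t s w x) (burau_act t s w d) k"
    using hurwitz_pair[where h = "\<lambda>p e. (fst p, fst (snd p), snd (snd p) + e)" and f = "ext t"
        and f' = "alexander t" and f'' = "ext t" and g = "ext_inv s" and g' = "alexander s"
        and g'' = "ext_inv s" and w = w and x = x and y = d and k = k]
    by (simp add: shift_def[abs_def] ext_def ext_inv_def alexander_def algebra_simps split: prod.splits)
qed

lemma fst_ext_act: "fst (ext_act t s w x k) = burau_act 1 1 w (\<lambda>j. fst (x j)) k"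
  by (rule hurwitz_rack_hom) (auto simp: ext_def ext_inv_def alexander_def)

lemma snd_ext_act: "fst (snd (ext_act t s w x k)) = burau_act t s w (\<lambda>j. fst (snd (x j))) k"
  by (rule hurwitz_rack_hom[where h = "\<lambda>p. fst (snd p)"]) (auto simp: ext_def ext_inv_def)

section \<open>Burau matrices and the Alexander rack\<close>

definition laurent_hom :: "(laurent \<Rightarrow> 'r::comm_ring_1) \<Rightarrow> bool" where
  "laurent_hom \<phi> \<longleftrightarrow> \<phi> 1 = 1 \<and> (\<forall>x y. \<phi> (x + y) = \<phi> x + \<phi> y) \<and> (\<forall>x y. \<phi> (x * y) = \<phi> x * \<phi> y)"

definition laurent_s :: laurent where
  "laurent_s = Poly_Mapping.single (- 1) 1"

lemma laurent_ts: "laurent_t * laurent_s = 1"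
  using laurent_t_inverse by (simp add: laurent_s_def)

lemma laurent_hom_simps:
  assumes "laurent_hom \<phi>"
  shows "\<phi> 1 = 1" "\<phi> 0 = 0" "\<phi> (x + y) = \<phi> x + \<phi> y" "\<phi> (x * y) = \<phi> x * \<phi> y"
    "\<phi> (x - y) = \<phi> x - \<phi> y" "\<phi> laurent_t * \<phi> laurent_s = 1"
proof -
  show 1: "\<phi> 1 = 1" and add: "\<phi> (x + y) = \<phi> x + \<phi> y" and m: "\<phi> (x * y) = \<phi> x * \<phi> y" for x y
    using assms by (auto simp: laurent_hom_def)
  show "\<phi> 0 = 0" using add[of 0 0] by simp
  show "\<phi> (x - y) = \<phi> x - \<phi> y" using add[of "x - y" y] by simp
  show "\<phi> laurent_t * \<phi> laurent_s = 1" using m[of laurent_t laurent_s] 1 laurent_ts by simp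
qed

text \<open>
  Entries from \<open>n\<close> on are left alone, as they are by words in \<open>\<sigma>\<^sub>1, \<dots>, \<sigma>\<^sub>n\<^sub>-\<^sub>1\<close>, so that the next
  lemmas are equations between functions on all natural numbers.
\<close>

definition mat_act :: "nat \<Rightarrow> (laurent \<Rightarrow> 'r::comm_ring_1) \<Rightarrow> laurent mat \<Rightarrow> (nat \<Rightarrow> 'r) \<Rightarrow> nat \<Rightarrow> 'r" where
  "mat_act n \<phi> M x r = (if r < n then \<Sum>k<n. \<phi> (M $$ (r, k)) * x k else x r)"

lemma mat_act_one:
  assumes "laurent_hom \<phi>" shows "mat_act n \<phi> (1\<^sub>m n) x = x"
proof
  fix r
  have "(\<Sum>k<n. \<phi> (1\<^sub>m n $$ (r, k)) * x k) = (\<Sum>k<n. if r = k then x k else 0)" if "r < n"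
    using that by (intro sum.cong) (simp_all add: laurent_hom_simps[OF assms])
  then show "mat_act n \<phi> (1\<^sub>m n) x r = x r" by (simp add: mat_act_def)
qed

lemma mat_act_burau_gen:
  assumes \<phi>: "laurent_hom \<phi>" and i: "1 \<le> i" "i < n" and M: "M \<in> carrier_mat n n"
  shows "mat_act n \<phi> (burau_gen n i * M) x
    = hurwitz_letter (alexander (\<phi> laurent_t)) (alexander (\<phi> laurent_s)) (i, True) (mat_act n \<phi> M x)"
proof
  fix r
  note h = laurent_hom_simps[OF \<phi>]
  show "mat_act n \<phi> (burau_gen n i * M) x r = hurwitz_letter (alexander (\<phi> laurent_t))
      (alexander (\<phi> laurent_s)) (i, True) (mat_act n \<phi> M x) r"
  proof (cases "r < n")
    case True
    then have "mat_act n \<phi> (burau_gen n i * M) x r = (\<Sum>k<n. \<phi> (if r = i - 1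
        then (1 - laurent_t) * M $$ (i - 1, k) + laurent_t * M $$ (i, k)
        else if r = i then 1 * M $$ (i - 1, k) + 0 * M $$ (i, k) else M $$ (r, k)) * x k)"
      unfolding mat_act_def using burau_gen_mult_index[OF i M True]
      by (simp del: index_mult_mat(1))
    moreover have "i - 1 < n" "i - 1 \<noteq> i" using i by auto
    ultimately show ?thesis
      using True i
      by (simp add: h mat_act_def hurwitz_letter_def alexander_def algebra_simps sum.distrib
          sum_distrib_left sum_subtractf)
  next
    case False
    moreover from False have "r \<noteq> i - 1" "r \<noteq> i" using i by auto
    ultimately show ?thesis by (simp add: mat_act_def hurwitz_letter_def)
  qed
qed

text \<open>
  Applying a ring homomorphism \<open>\<phi>\<close> to the entries specializes \<open>t\<close>. Besides the generic value, the
  value \<open>t = 1\<close> is used below: there the action permutes the entries, so that the Burau kernel is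
  seen to consist of pure braids.
\<close>

lemma burau_act_eq_mat_act:
  assumes \<phi>: "laurent_hom \<phi>" and w: "w \<in> braid_words n"
  shows "burau_act (\<phi> laurent_t) (\<phi> laurent_s) w x = mat_act n \<phi> (burau_word n w) x"
  using w
proof (induction w)
  case Nil
  then show ?case by (simp add: mat_act_one[OF \<phi>])
next
  case (Cons l w)
  obtain i b where l: "l = (i, b)" by force
  interpret rack "alexander (\<phi> laurent_t)" "alexander (\<phi> laurent_s)"
    by (rule rack_alexander[OF laurent_hom_simps(6)[OF \<phi>]])
  interpret G: group "GL_laurent n" by (rule group_GL_laurent)
  have i: "1 \<le> i" "i < n" and w: "w \<in> braid_words n" using Cons.prems by (auto simp: l)
  note IH = Cons.IH[OF w]
  have g: "burau_gen n i \<in> carrier (GL_laurent n)" by (rule burau_gen_GL[OF i])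
  have M: "burau_word n w \<in> carrier (GL_laurent n)" by (rule burau_word_GL[OF w])
  show ?case
  proof (cases b)
    case True
    then show ?thesis
      using mat_act_burau_gen[OF \<phi> i GL_laurent_carrier_mat[OF M]] GL_laurent_carrier_mat[OF M]
      by (simp add: l IH burau_letter_def)
  next
    case False
    \<comment> \<open>The two sides agree after applying \<open>\<sigma>\<^sub>i\<close>, which acts injectively.\<close>
    define N where "N = inv\<^bsub>GL_laurent n\<^esub> (burau_gen n i) * burau_word n w"
    have "N \<in> carrier (GL_laurent n)"
      using G.m_closed[OF G.inv_closed[OF g] M] by (simp add: N_def)
    moreover have "burau_gen n i * N = burau_word n w"
      using G.inv_solve_left[OF g M G.m_closed[OF G.inv_closed[OF g] M]]
        G.m_assoc[OF g G.inv_closed[OF g] M] G.r_inv[OF g] GL_laurent_carrier_mat[OF M]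
      by (simp add: N_def)
    ultimately have "mat_act n \<phi> (burau_word n w) x = hurwitz_letter (alexander (\<phi> laurent_t))
        (alexander (\<phi> laurent_s)) (i, True) (mat_act n \<phi> N x)"
      using mat_act_burau_gen[OF \<phi> i GL_laurent_carrier_mat, where M = N and x = x] by simp
    then show ?thesis
      using hurwitz_letter_cancel[OF i(1), of False "mat_act n \<phi> N x"] False
      by (simp add: l IH burau_letter_def N_def)
  qed
qed

lemma burau_word_oneI:
  assumes w: "w \<in> braid_words n" and triv: "\<And>x. burau_act laurent_t laurent_s w x = x"
  shows "burau_word n w = 1\<^sub>m n"
proof (rule eq_matI)
  show d: "dim_row (burau_word n w) = dim_row (1\<^sub>m n)" "dim_col (burau_word n w) = dim_col (1\<^sub>m n)"
    using GL_laurent_carrier_mat[OF burau_word_GL[OF w]] by auto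
  fix r k assume "r < dim_row (1\<^sub>m n :: laurent mat)" "k < dim_col (1\<^sub>m n :: laurent mat)"
  then have rk: "r < n" "k < n" by auto
  have id: "laurent_hom (\<lambda>x :: laurent. x)" by (simp add: laurent_hom_def)
  have "mat_act n (\<lambda>x. x) (burau_word n w) (\<lambda>j. if j = k then 1 else 0) r
      = (if r = k then 1 else 0)"
    using burau_act_eq_mat_act[OF id w, of "\<lambda>j. if j = k then 1 else 0"] by (simp add: triv)
  then show "burau_word n w $$ (r, k) = 1\<^sub>m n $$ (r, k)"
    using rk by (simp add: mat_act_def if_distrib[of "\<lambda>z. _ * z"] cong: if_cong)
qed

section \<open>Evaluation of formal sums\<close>

definition frag_eval :: "('k \<Rightarrow> 'r::comm_ring_1) \<Rightarrow> ('k \<Rightarrow>\<^sub>0 int) \<Rightarrow> 'r" where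
  "frag_eval h p = (\<Sum>k\<in>Poly_Mapping.keys p. of_int (Poly_Mapping.lookup p k) * h k)"

lemma frag_eval_superset:
  assumes "finite S" "Poly_Mapping.keys p \<subseteq> S"
  shows "frag_eval h p = (\<Sum>k\<in>S. of_int (Poly_Mapping.lookup p k) * h k)"
  unfolding frag_eval_def using assms
  by (intro sum.mono_neutral_left) (auto simp: in_keys_iff)

lemma frag_eval_add: "frag_eval h (p + q) = frag_eval h p + frag_eval h q"
proof -
  let ?S = "Poly_Mapping.keys p \<union> Poly_Mapping.keys q"
  have "frag_eval h (p + q) = (\<Sum>k\<in>?S. of_int (Poly_Mapping.lookup (p + q) k) * h k)"
    by (rule frag_eval_superset) (use Poly_Mapping.keys_add[of p q] in auto)
  also have "\<dots> = frag_eval h p + frag_eval h q"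
    using frag_eval_superset[of ?S p h] frag_eval_superset[of ?S q h]
    by (simp add: lookup_add sum.distrib distrib_right)
  finally show ?thesis .
qed

lemma frag_eval_simps [simp]:
  "frag_eval h 0 = 0"
  "frag_eval h (p + q) = frag_eval h p + frag_eval h q"
  "frag_eval h (p - q) = frag_eval h p - frag_eval h q"
  "frag_eval h (- p) = - frag_eval h p"
  "frag_eval h (Poly_Mapping.single k c) = of_int c * h k"
proof -
  show 0: "frag_eval h 0 = 0" by (simp add: frag_eval_def)
  show "frag_eval h (p + q) = frag_eval h p + frag_eval h q" by (rule frag_eval_add)
  show "frag_eval h (p - q) = frag_eval h p - frag_eval h q"
    using frag_eval_add[of h "p - q" q] by simp
  show "frag_eval h (- p) = - frag_eval h p"
    using frag_eval_add[of h "- p" p] 0 by (simp add: eq_neg_iff_add_eq_0)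
  show "frag_eval h (Poly_Mapping.single k c) = of_int c * h k"
    by (simp add: frag_eval_def)
qed

text \<open>The sum of the coefficients, that is, the evaluation at \<open>t = 1\<close>.\<close>

lemma laurent_hom_augmentation: "laurent_hom (frag_eval (\<lambda>_. 1) :: laurent \<Rightarrow> 'r::comm_ring_1)"
proof -
  have frag: "frag_eval (\<lambda>_. 1) (frag_of a * q) = (frag_eval (\<lambda>_. 1) q :: 'r)" for a :: int and q
  proof -
    have "Poly_Mapping.keys q \<subseteq> UNIV" by simp
    then show ?thesis
      by (induction q rule: frag_induction) (simp_all add: mult_single right_diff_distrib)
  qed
  have "frag_eval (\<lambda>_. 1) (p * q) = (frag_eval (\<lambda>_. 1) p * frag_eval (\<lambda>_. 1) q :: 'r)"
    for p q :: laurent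
  proof -
    have "Poly_Mapping.keys p \<subseteq> UNIV" by simp
    then show ?thesis
      by (induction p rule: frag_induction) (simp_all add: frag left_diff_distrib)
  qed
  then show ?thesis
    by (simp add: laurent_hom_def single_one[symmetric] del: single_one)
qed

section \<open>Criteria for infinite rank and infinite generation\<close>

text \<open>
  A triangular system of homomorphisms to \<open>\<int>\<close> detects infinitely many independent elements. The
  homomorphisms \<open>\<psi> m\<close> extend to linear functionals \<open>T m\<close> on \<open>A \<otimes> \<rat>\<close>; applying the functional of
  the largest index that occurs in a vanishing linear combination of the \<open>g k \<otimes> 1\<close> isolates the
  coefficient at that index.
\<close>

lemma infinite_rankI:
  fixes A :: "('a, 'b) monoid_scheme" (structure) and \<psi> :: "nat \<Rightarrow> 'a \<Rightarrow> int"
  assumes A: "comm_group A" and g: "\<And>k. g k \<in> carrier A"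
    and add: "\<And>m x y. \<lbrakk>x \<in> carrier A; y \<in> carrier A\<rbrakk> \<Longrightarrow> \<psi> m (x \<otimes> y) = \<psi> m x + \<psi> m y"
    and diag: "\<And>m. \<psi> m (g m) \<noteq> 0" and tri: "\<And>k m. k < m \<Longrightarrow> \<psi> m (g k) = 0"
  shows "infinite_rank A"
proof -
  interpret V: vectorspace "class_ring :: rat ring" "tensor_rat A"
    by (rule vectorspace_tensor_rat[OF A])
  interpret F: comm_group "tensor_free A" by (rule abelian_free_Abelian_group)
  define N where "N = tensor_null A"
  \<comment> \<open>The functional of \<open>\<psi> m\<close> on formal sums, and its descent to the cosets of \<open>N\<close>.\<close>
  define \<eta> where "\<eta> m = frag_eval (\<lambda>(a, q :: rat). of_int (\<psi> m a) * q)" for m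
  define T where "T m X = (the_elem (\<eta> m ` X) :: rat)" for m and X :: "('a \<times> rat \<Rightarrow>\<^sub>0 int) set"
  have rel: "\<eta> m x = 0" if "x \<in> tensor_rels A" for m x
    using that by (auto simp: tensor_rels_def \<eta>_def add distrib_left distrib_right)
  have null: "\<eta> m x = 0" if "x \<in> N" for m x
    using that unfolding N_def tensor_null_def
  proof (induction rule: generate.induct)
    case (inv h)
    then have "inv\<^bsub>tensor_free A\<^esub> h = - h" using tensor_rels_carrier[OF A] by auto
    then show ?case using rel[OF inv] by (simp add: \<eta>_def)
  qed (simp_all add: rel, simp_all add: \<eta>_def)
  have scale: "\<eta> m (tensor_scale p x) = p * \<eta> m x" for m p x
  proof -
    have "Poly_Mapping.keys x \<subseteq> UNIV" by simp
    then show ?thesis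
      by (induction x rule: frag_induction)
        (auto simp: tensor_scale_simps \<eta>_def right_diff_distrib)
  qed
  have T_coset: "T m (N #>\<^bsub>tensor_free A\<^esub> x) = \<eta> m x" for m x
  proof -
    have "\<eta> m y = \<eta> m x" if "y \<in> N #>\<^bsub>tensor_free A\<^esub> x" for y
      using that null by (auto simp: r_coset_def \<eta>_def)
    moreover have "x \<in> N #>\<^bsub>tensor_free A\<^esub> x"
      using tensor_null_closed(1)[OF A] by (force simp: r_coset_def N_def)
    ultimately have "\<eta> m ` (N #>\<^bsub>tensor_free A\<^esub> x) = {\<eta> m x}" by blast
    then show ?thesis by (simp add: T_def)
  qed
  have T_add: "T m (X \<oplus>\<^bsub>tensor_rat A\<^esub> Y) = T m X + T m Y"
    if X: "X \<in> carrier (tensor_rat A)" and Y: "Y \<in> carrier (tensor_rat A)" for m X Y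
  proof -
    obtain x where x: "x \<in> carrier (tensor_free A)" "X = N #>\<^bsub>tensor_free A\<^esub> x"
      unfolding N_def by (rule tensor_carrierE[OF A X])
    obtain y where y: "y \<in> carrier (tensor_free A)" "Y = N #>\<^bsub>tensor_free A\<^esub> y"
      unfolding N_def by (rule tensor_carrierE[OF A Y])
    show ?thesis
      unfolding x(2) y(2) tensor_add_coset[OF A x(1) y(1), folded N_def] T_coset by (simp add: \<eta>_def)
  qed
  have T_smult: "T m (p \<odot>\<^bsub>tensor_rat A\<^esub> X) = p * T m X"
    if X: "X \<in> carrier (tensor_rat A)" for m p X
  proof -
    obtain x where x: "x \<in> carrier (tensor_free A)" "X = N #>\<^bsub>tensor_free A\<^esub> x"
      unfolding N_def by (rule tensor_carrierE[OF A X])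
    show ?thesis
      unfolding x(2) tensor_smult_coset[OF A x(1), folded N_def] T_coset by (rule scale)
  qed
  have T_zero: "T m \<zero>\<^bsub>tensor_rat A\<^esub> = 0" for m
    using T_smult[OF V.zero_closed, of m 0] by simp
  have T_lincomb: "T m (V.lincomb a S) = (\<Sum>v\<in>S. a v * T m v)"
    if "finite S" "S \<subseteq> carrier (tensor_rat A)" for m a S
    using that
  proof (induction S rule: finite_induct)
    case empty
    then show ?case by (simp add: V.lincomb_def T_zero)
  next
    case (insert v S)
    then have "V.lincomb a (insert v S) = a v \<odot>\<^bsub>tensor_rat A\<^esub> v \<oplus>\<^bsub>tensor_rat A\<^esub> V.lincomb a S"
      unfolding V.lincomb_def by (intro V.finsum_insert) auto
    moreover have "V.lincomb a S \<in> carrier (tensor_rat A)"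
      using insert by (intro V.lincomb_closed) auto
    ultimately show ?case using insert by (simp add: T_add T_smult)
  qed
  define X where "X k = N #>\<^bsub>tensor_free A\<^esub> frag_of (g k, 1 :: rat)" for k
  have X: "X k \<in> carrier (tensor_rat A)" for k
    unfolding X_def N_def using g by (intro tensor_carrierI[OF A]) simp
  have TX: "T m (X k) = of_int (\<psi> m (g k))" for m k
    unfolding X_def T_coset by (simp add: \<eta>_def)
  have "inj X"
  proof (rule linorder_injI)
    fix k m :: nat assume "k < m"
    then show "X k \<noteq> X m" using TX[of m m] TX[of m k] diag[of m] tri[of k m] by auto
  qed
  have indep: "V.lin_indpt (range X)"
  proof
    assume "V.lin_dep (range X)"
    then obtain S a v where S: "finite S" "S \<subseteq> range X" and zero: "V.lincomb a S = \<zero>\<^bsub>tensor_rat A\<^esub>"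
      and v: "v \<in> S" "a v \<noteq> (0 :: rat)"
      by (auto simp: V.lin_dep_def)
    define K where "K = {k. X k \<in> S \<and> a (X k) \<noteq> 0}"
    have "finite K"
      by (rule finite_subset[OF _ finite_vimageI[OF S(1) \<open>inj X\<close>]]) (auto simp: K_def)
    moreover have "K \<noteq> {}" using v S(2) by (auto simp: K_def)
    ultimately have m: "Max K \<in> K" and le: "\<And>k. k \<in> K \<Longrightarrow> k \<le> Max K" by simp_all
    define m where "m = Max K"
    have "a v * T m v = 0" if v: "v \<in> S - {X m}" for v
    proof -
      obtain k where "v = X k" using v S(2) by blast
      then have k: "v = X k" "X k \<in> S" "k \<noteq> m" using v by auto
      show ?thesis
      proof (cases "k \<in> K")
        case True
        then have "k < m" using le k(3) by (force simp: m_def)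
        then show ?thesis by (simp add: k(1) TX tri)
      qed (use k in \<open>simp add: K_def\<close>)
    qed
    then have "(\<Sum>v\<in>S - {X m}. a v * T m v) = 0" by (intro sum.neutral ballI)
    moreover have Xm: "X m \<in> S" "a (X m) \<noteq> 0" using m by (simp_all add: m_def K_def)
    ultimately have "(\<Sum>v\<in>S. a v * T m v) = a (X m) * T m (X m)"
      using sum.remove[OF S(1) Xm(1), of "\<lambda>v. a v * T m v"] by simp
    moreover have "(\<Sum>v\<in>S. a v * T m v) = 0"
      using T_lincomb[OF S(1), of m a] S(2) X zero T_zero by auto
    ultimately show False using Xm(2) diag by (simp add: TX)
  qed
  have "\<not> V.fin_dim"
  proof
    assume "V.fin_dim"
    then have "finite (range X)" using V.li_le_dim(1)[OF _ _ indep] X by auto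
    then show False using \<open>inj X\<close> range_inj_infinite by blast
  qed
  then show ?thesis by (simp add: infinite_rank_def)
qed

text \<open>Homomorphisms to \<open>\<int>\<close> kill commutators, so they factor through \<open>H\<^sub>1\<close>.\<close>

lemma infinite_rank_H1I:
  fixes G :: "('a, 'b) monoid_scheme" (structure) and \<psi> :: "nat \<Rightarrow> 'a \<Rightarrow> int"
  assumes G: "group G" and g: "\<And>k. g k \<in> carrier G"
    and add: "\<And>m x y. \<lbrakk>x \<in> carrier G; y \<in> carrier G\<rbrakk> \<Longrightarrow> \<psi> m (x \<otimes> y) = \<psi> m x + \<psi> m y"
    and diag: "\<And>m. \<psi> m (g m) \<noteq> 0" and tri: "\<And>k m. k < m \<Longrightarrow> \<psi> m (g k) = 0"
  shows "infinite_rank (H1 G)"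
proof -
  interpret group G by (rule G)
  define D where "D = derived G (carrier G)"
  interpret D: normal D G unfolding D_def by (rule derived_self_is_normal)
  have one: "\<psi> m \<one> = 0" for m using add[of \<one> \<one> m] by simp
  have minv: "\<psi> m (inv x) = - \<psi> m x" if "x \<in> carrier G" for m x
    using add[of "inv x" x m] that one[of m] by simp
  have comm: "x \<in> carrier G \<and> \<psi> m x = 0" if x: "x \<in> derived_set G (carrier G)" for m x
  proof -
    obtain a b where "a \<in> carrier G" "b \<in> carrier G" "x = a \<otimes> b \<otimes> inv a \<otimes> inv b"
      using x by blast
    then show ?thesis by (simp add: add minv)
  qed
  have D0: "x \<in> carrier G \<and> \<psi> m x = 0" if "x \<in> D" for m x
    using that unfolding D_def derived_def
  proof (induction rule: generate.induct)
    case (inv h)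
    then show ?case using comm[OF inv] minv by simp
  next
    case (incl h)
    then show ?case by (rule comm)
  qed (simp_all add: one add)
  have coset: "the_elem (\<psi> m ` (D #> x)) = \<psi> m x" if x: "x \<in> carrier G" for m x
  proof -
    have "\<psi> m y = \<psi> m x" if "y \<in> D #> x" for y
      using that x D0 D.subset by (auto simp: r_coset_def add subset_iff)
    then have "\<psi> m ` (D #> x) = {\<psi> m x}" using rcos_self[OF x D.subgroup_axioms] by blast
    then show ?thesis by simp
  qed
  show ?thesis
  proof (rule infinite_rankI[OF comm_group_H1[OF G], where g = "\<lambda>k. D #> g k"
        and \<psi> = "\<lambda>m C. the_elem (\<psi> m ` C)"])
    show "D #> g k \<in> carrier (H1 G)" for k
      using g by (auto simp: H1_def D_def carrier_FactGroup)
    fix m x y assume "x \<in> carrier (H1 G)" "y \<in> carrier (H1 G)"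
    then obtain x' y' where "x' \<in> carrier G" "x = D #> x'" "y' \<in> carrier G" "y = D #> y'"
      by (auto simp: H1_def D_def carrier_FactGroup)
    then show "the_elem (\<psi> m ` (x \<otimes>\<^bsub>H1 G\<^esub> y)) = the_elem (\<psi> m ` x) + the_elem (\<psi> m ` y)"
      by (simp add: H1_def D_def[symmetric] D.rcos_sum coset add)
  qed (use g diag tri in \<open>simp_all add: coset\<close>)
qed

text \<open>
  If every element is seen by finitely many of the \<open>\<psi> m\<close>, then some \<open>\<psi> m\<close> vanishes on a given
  finite set, hence on the subgroup that it generates.
\<close>

lemma not_finitely_generatedI:
  fixes G :: "('a, 'b) monoid_scheme" (structure) and \<psi> :: "nat \<Rightarrow> 'a \<Rightarrow> int"
  assumes G: "group G"
    and add: "\<And>m x y. \<lbrakk>x \<in> carrier G; y \<in> carrier G\<rbrakk> \<Longrightarrow> \<psi> m (x \<otimes> y) = \<psi> m x + \<psi> m y"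
    and fin: "\<And>x. x \<in> carrier G \<Longrightarrow> finite {m. \<psi> m x \<noteq> 0}"
    and nz: "\<And>m. \<exists>x\<in>carrier G. \<psi> m x \<noteq> 0"
  shows "\<not> (\<exists>S. finite S \<and> S \<subseteq> carrier G \<and> generate G S = carrier G)"
proof
  assume "\<exists>S. finite S \<and> S \<subseteq> carrier G \<and> generate G S = carrier G"
  then obtain S where S: "finite S" "S \<subseteq> carrier G" "generate G S = carrier G" by blast
  interpret group G by (rule G)
  have "finite (\<Union>x\<in>S. {m. \<psi> m x \<noteq> 0})" using S fin by auto
  then obtain m where m: "m \<notin> (\<Union>x\<in>S. {m. \<psi> m x \<noteq> 0})" using ex_new_if_finite infinite_UNIV_nat by blast
  have one: "\<psi> m \<one> = 0" using add[of \<one> \<one> m] by simp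
  have inv: "\<psi> m (inv x) = - \<psi> m x" if "x \<in> carrier G" for x
    using add[of "inv x" x m] that one by simp
  have "\<psi> m x = 0" if "x \<in> generate G S" for x
    using that
  proof (induction rule: generate.induct)
    case (inv h)
    then show ?case using S(2) m \<open>\<And>x. x \<in> carrier G \<Longrightarrow> \<psi> m (inv x) = - \<psi> m x\<close> by auto
  next
    case (eng h1 h2)
    then show ?case using S(3) by (simp add: add)
  qed (use m one in auto)
  then show False using nz[of m] S(3) by auto
qed

section \<open>A Johnson homomorphism on the Burau kernel\<close>

abbreviation t :: laurent where "t \<equiv> laurent_t"
abbreviation s :: laurent where "s \<equiv> laurent_s"

definition Bur_words :: "nat \<Rightarrow> braid_word set" where
  "Bur_words n = {w \<in> braid_words n. burau_word n w = 1\<^sub>m n}"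

lemma Bur_words_burau_act:
  assumes w: "w \<in> Bur_words n"
  shows "burau_act t s w x = x" "burau_act 1 1 w x = (x :: nat \<Rightarrow> laurent)"
proof -
  have w1: "w \<in> braid_words n" "burau_word n w = 1\<^sub>m n" using w by (auto simp: Bur_words_def)
  have id: "laurent_hom (\<lambda>x :: laurent. x)" by (simp add: laurent_hom_def)
  show "burau_act t s w x = x"
    using burau_act_eq_mat_act[OF id w1(1)] by (simp add: w1(2) mat_act_one[OF id])
  note aug = laurent_hom_augmentation[where 'r = laurent]
  show "burau_act 1 1 w x = x"
    using burau_act_eq_mat_act[OF aug w1(1)]
    by (simp add: w1(2) mat_act_one[OF aug] laurent_t_def laurent_s_def)
qed

text \<open>
  Tuples with explicit entries \<open>0, \<dots>, 5\<close>, on which words in \<open>\<sigma>\<^sub>1, \<dots>, \<sigma>\<^sub>5\<close> are evaluated by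
  rewriting. The first argument is the common value of the remaining entries.
\<close>

definition six :: "'a \<Rightarrow> 'a \<Rightarrow> 'a \<Rightarrow> 'a \<Rightarrow> 'a \<Rightarrow> 'a \<Rightarrow> 'a \<Rightarrow> nat \<Rightarrow> 'a" where
  "six z a b c d e f = (\<lambda>_. z)(0 := a, 1 := b, 2 := c, 3 := d, 4 := e, 5 := f)"

lemma hurwitz_letter_six:
  "hurwitz_letter p q (1, True) (six z a b c d e f) = six z (p a b) a c d e f"
  "hurwitz_letter p q (2, True) (six z a b c d e f) = six z a (p b c) b d e f"
  "hurwitz_letter p q (3, True) (six z a b c d e f) = six z a b (p c d) c e f"
  "hurwitz_letter p q (4, True) (six z a b c d e f) = six z a b c (p d e) d f"
  "hurwitz_letter p q (5, True) (six z a b c d e f) = six z a b c d (p e f) e"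
  "hurwitz_letter p q (1, False) (six z a b c d e f) = six z b (q b a) c d e f"
  "hurwitz_letter p q (2, False) (six z a b c d e f) = six z a c (q c b) d e f"
  "hurwitz_letter p q (3, False) (six z a b c d e f) = six z a b d (q d c) e f"
  "hurwitz_letter p q (4, False) (six z a b c d e f) = six z a b c e (q e d) f"
  "hurwitz_letter p q (5, False) (six z a b c d e f) = six z a b c d f (q f e)"
  by (simp_all add: hurwitz_letter_def six_def fun_eq_iff)

lemma six_nth [simp]: "six z a b c d e f 2 = c" "six z a b c d e f 3 = d"
  by (simp_all add: six_def)

text \<open>
  All last components are zero, and the entries 2 and 3, which \<open>\<sigma>\<^sub>3\<close> exchanges, are equal, so that
  \<open>\<sigma>\<^sub>3\<close> fixes this tuple.
\<close>

definition base :: "nat \<Rightarrow> laurent triple" where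
  "base = six (0, 0, 0) (0, 0, 0) (0, 0, 0) (0, 1, 0) (0, 1, 0) (0, 0, 0) (1, 0, 0)"

definition displacement :: "braid_word \<Rightarrow> nat \<Rightarrow> laurent" where
  "displacement w k = snd (snd (ext_act t s w base k))"

interpretation A: rack "alexander t" "alexander s"
  by (rule rack_alexander[OF laurent_ts])

interpretation E: rack "ext t" "ext_inv s"
  by (rule rack_ext[OF laurent_ts])

lemma snd_snd_base: "snd (snd (base k)) = 0"
  by (simp add: base_def six_def)

lemma shift_shift: "shift (shift x d) e = shift x (\<lambda>k. d k + e k)"
  by (simp add: shift_def fun_eq_iff add.assoc)

lemma snd_snd_shift_base: "snd (snd (shift base d k)) = d k"
  by (simp add: shift_def snd_snd_base)

text \<open>
  The first two components transform by the Burau action for \<open>1\<close> and for \<open>t\<close>, which the word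
  does not feel; so only the last components can move.
\<close>

lemma ext_act_Bur:
  assumes w: "w \<in> Bur_words n" shows "ext_act t s w base = shift base (displacement w)"
proof
  fix k
  have "fst (ext_act t s w base k) = fst (base k)"
    by (simp add: fst_ext_act Bur_words_burau_act[OF w])
  moreover have "fst (snd (ext_act t s w base k)) = fst (snd (base k))"
    by (simp add: snd_ext_act Bur_words_burau_act[OF w])
  ultimately show "ext_act t s w base k = shift base (displacement w) k"
    by (simp add: shift_def displacement_def prod_eq_iff snd_snd_base)
qed

text \<open>The functional \<open>w \<mapsto> w 2 - w 3\<close> is taken because it is an eigenvector of \<open>\<sigma>\<^sub>3\<close>.\<close>

definition johnson :: "braid_word \<Rightarrow> laurent" where
  "johnson w = displacement w 2 - displacement w 3"

lemma johnson_append: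
  assumes v: "v \<in> Bur_words n" and w: "w \<in> Bur_words n"
  shows "johnson (v @ w) = johnson v + johnson w"
proof -
  have "ext_act t s (v @ w) base = shift base (\<lambda>k. displacement v k + displacement w k)"
    by (simp add: hurwitz_append ext_act_Bur[OF w] ext_act_shift ext_act_Bur[OF v]
        Bur_words_burau_act[OF v] shift_shift)
  then have "displacement (v @ w) k = displacement v k + displacement w k" for k
    unfolding displacement_def[of "v @ w"] by (simp add: snd_snd_shift_base)
  then show ?thesis by (simp add: johnson_def)
qed

lemma johnson_cong: "braid_eq n v w \<Longrightarrow> johnson v = johnson w"
  by (simp add: johnson_def displacement_def E.hurwitz_cong)

text \<open>
  Under Burau \<open>\<sigma>\<^sub>3\<close> is the identity minus \<open>d \<otimes> p\<close>, where \<open>d x = x 2 - x 3\<close> and \<open>p\<close> is this vector.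
\<close>

definition arc_vector :: "nat \<Rightarrow> laurent" where
  "arc_vector k = (if k = 2 then t else if k = 3 then - 1 else 0)"

lemma arc_vector_six: "arc_vector = six 0 0 0 t (- 1) 0 0"
  by (simp add: arc_vector_def six_def fun_eq_iff)

lemma burau_act_sigma3:
  "burau_act t s [(3, True)] x = (\<lambda>k. x k + (x 3 - x 2) * arc_vector k)" (is ?A)
  "burau_act t s [(3, False)] x = (\<lambda>k. x k + s * (x 3 - x 2) * arc_vector k)" (is ?B)
proof -
  note simps = hurwitz_letter_def alexander_def arc_vector_def algebra_simps unit_rules[OF laurent_ts]
  have cases: "k = 2 \<or> k = 3 \<or> k \<noteq> 2 \<and> k \<noteq> 3" for k :: nat by blast
  show ?A
  proof
    fix k show "burau_act t s [(3, True)] x k = x k + (x 3 - x 2) * arc_vector k"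
      using cases[of k] by (elim disjE) (simp_all add: simps)
  qed
  show ?B
  proof
    fix k show "burau_act t s [(3, False)] x k = x k + s * (x 3 - x 2) * arc_vector k"
      using cases[of k] by (elim disjE) (simp_all add: simps)
  qed
qed

lemma ext_act_sigma3:
  assumes "fst (x 2) = fst (x 3)" "fst (snd (x 2)) = fst (snd (x 3))"
  shows "ext_act t s [(3, True)] x
    = shift x (\<lambda>k. (snd (snd (x 3)) - snd (snd (x 2))) * arc_vector k)"
proof
  fix k :: nat
  obtain a b c c' where x: "x 2 = (a, b, c)" "x 3 = (a, b, c')"
    using assms by (metis prod.collapse)
  have "k = 2 \<or> k = 3 \<or> k \<noteq> 2 \<and> k \<noteq> 3" by blast
  then show "ext_act t s [(3, True)] x k
    = shift x (\<lambda>k. (snd (snd (x 3)) - snd (snd (x 2))) * arc_vector k) k"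
    by (elim disjE) (simp_all add: x hurwitz_letter_def ext_def alexander_def shift_def
        arc_vector_def algebra_simps prod_eq_iff)
qed

lemma ext_act_sigma3_base: "ext_act t s [(3, False)] base = base"
  by (simp add: base_def hurwitz_letter_six ext_def ext_inv_def alexander_def)

definition conj_sigma3 :: "braid_word \<Rightarrow> braid_word" where
  "conj_sigma3 w = [(3, True)] @ w @ [(3, False)]"

lemma Bur_wordsI:
  "w \<in> braid_words n \<Longrightarrow> (\<And>x. burau_act t s w x = x) \<Longrightarrow> w \<in> Bur_words n"
  by (simp add: Bur_words_def burau_word_oneI)

text \<open>
  The conjugating \<open>\<sigma>\<^sub>3\<inverse>\<close> fixes the base tuple, so conjugation just applies \<open>\<sigma>\<^sub>3\<close> to the
  displacement, and \<open>w \<mapsto> w 2 - w 3\<close> is an eigenvector of \<open>\<sigma>\<^sub>3\<close> for the eigenvalue \<open>- t\<close>.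
\<close>

lemma conj_sigma3:
  assumes n: "3 < n" and w: "w \<in> Bur_words n"
  shows "conj_sigma3 w \<in> Bur_words n" "johnson (conj_sigma3 w) = - t * johnson w"
proof -
  have inv: "burau_act t s [(3, True)] (burau_act t s [(3, False)] x) = x" for x
    using A.hurwitz_letter_cancel[of 3 True] by simp
  show "conj_sigma3 w \<in> Bur_words n"
  proof (rule Bur_wordsI)
    show "conj_sigma3 w \<in> braid_words n" using n w by (simp add: conj_sigma3_def Bur_words_def)
    fix x show "burau_act t s (conj_sigma3 w) x = x"
      unfolding conj_sigma3_def hurwitz_append Bur_words_burau_act(1)[OF w] by (rule inv)
  qed
  have e: "ext_act t s [(3, True)] base = base"
    using E.hurwitz_letter_cancel[of 3 True base] ext_act_sigma3_base by simp
  have "ext_act t s (conj_sigma3 w) base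
      = shift base (burau_act t s [(3, True)] (displacement w))"
    unfolding conj_sigma3_def hurwitz_append ext_act_sigma3_base ext_act_Bur[OF w] ext_act_shift e ..
  then have d: "displacement (conj_sigma3 w) k
      = displacement w k + (displacement w 3 - displacement w 2) * arc_vector k" for k
    unfolding displacement_def[of "conj_sigma3 w"] burau_act_sigma3 by (simp add: snd_snd_shift_base)
  show "johnson (conj_sigma3 w) = - t * johnson w"
    unfolding johnson_def d by (simp add: arc_vector_def algebra_simps)
qed

section \<open>Two half twists that commute under Burau\<close>

text \<open>
  \<open>\<theta> = \<sigma>\<^sub>2 \<sigma>\<^sub>1\<^sup>-\<^sup>3 \<sigma>\<^sub>2 \<cdot> \<sigma>\<^sub>4\<inverse> \<sigma>\<^sub>5\<^sup>3 \<sigma>\<^sub>4\<inverse>\<close> moves the first three strands and the last three strands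
  separately. In each pairing below the two halves contribute opposite Laurent polynomials; the
  exponents are chosen for this cancellation.
\<close>

definition theta :: braid_word where
  "theta = [(2, True), (1, False), (1, False), (1, False), (2, True),
            (4, False), (5, True), (5, True), (5, True), (4, False)]"

text \<open>
  The vector \<open>p\<close> is that of \<open>\<sigma>\<^sub>3\<close>. The equations say that \<open>d (\<theta> p) = 0\<close> and \<open>d (\<theta>\<inverse> p) = 0\<close>, that is,
  that the algebraic intersection of the arcs of \<open>\<sigma>\<^sub>3\<close> and of \<open>\<theta>\<inverse> \<sigma>\<^sub>3 \<theta>\<close> vanishes in both orders.
\<close>

lemma theta_pairing:
  "burau_act t s theta arc_vector 2 = burau_act t s theta arc_vector 3"
  "burau_act t s (inv_word theta) arc_vector 2 = burau_act t s (inv_word theta) arc_vector 3"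
  by (simp_all del: One_nat_def add: arc_vector_six theta_def hurwitz_letter_six alexander_def
      algebra_simps unit_rules[OF laurent_ts])

definition second_twist :: braid_word where
  "second_twist = inv_word theta @ [(3, False)] @ theta"

text \<open>
  The second twist displaces the last components of the entries 2 and 3 by different amounts, although their first
  two components stay equal. This difference is what keeps the two twists from commuting on
  triples.
\<close>

lemma arc_displacement:
  fixes y defines "y \<equiv> ext_act t s second_twist base"
  shows "fst (y 2) = fst (y 3)" "fst (snd (y 2)) = fst (snd (y 3))"
    "snd (snd (y 3)) - snd (snd (y 2)) = t - t * t * t"
  by (simp_all del: One_nat_def add: y_def second_twist_def base_def theta_def hurwitz_letter_six
      ext_def ext_inv_def alexander_def algebra_simps unit_rules[OF laurent_ts])

lemma burau_act_second_twist:
  "burau_act t s second_twist x = (\<lambda>k. x k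
    + s * (burau_act t s theta x 3 - burau_act t s theta x 2) * burau_act t s (inv_word theta) arc_vector k)"
proof -
  have th: "theta \<in> braid_words 6" by (simp add: theta_def)
  show ?thesis
    unfolding second_twist_def hurwitz_append burau_act_sigma3 burau_act_add burau_act_scale
      A.hurwitz_inv_word[OF th] ..
qed

definition arc_commutator :: braid_word where
  "arc_commutator = inv_word second_twist @ [(3, True)] @ second_twist @ [(3, False)]"

lemma second_twist_words: "6 \<le> n \<Longrightarrow> second_twist \<in> braid_words n"
  by (simp add: second_twist_def theta_def)

text \<open>
  Under Burau both twists are the identity plus a map of rank one, and \<open>theta_pairing\<close> makes the
  product of the two rank-one maps vanish in either order. So the twists commute.
\<close>

lemma arc_commutator_Bur: assumes "6 \<le> n" shows "arc_commutator \<in> Bur_words n"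
proof (rule Bur_wordsI)
  show "arc_commutator \<in> braid_words n" using assms second_twist_words[OF assms] by (simp add: arc_commutator_def)
  fix x
  have comm: "burau_act t s [(3, True)] (burau_act t s second_twist x)
      = burau_act t s second_twist (burau_act t s [(3, True)] x)" for x
    by (simp only: burau_act_sigma3 burau_act_second_twist burau_act_add burau_act_scale theta_pairing)
      (simp add: fun_eq_iff algebra_simps)
  have inv: "burau_act t s [(3, True)] (burau_act t s [(3, False)] x) = x" for x
    using A.hurwitz_letter_cancel[of 3 True] by simp
  show "burau_act t s arc_commutator x = x"
    unfolding arc_commutator_def hurwitz_append comm inv A.hurwitz_inv_word[OF second_twist_words[OF assms]] ..
qed

text \<open>
  Read from the right: \<open>\<sigma>\<^sub>3\<inverse>\<close> fixes the base tuple, the second half twist takes it to \<open>y\<close>, and on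
  \<open>y\<close> the twist \<open>\<sigma>\<^sub>3\<close> only adds a multiple of the vector \<open>p\<close> to the last components. The inverse of
  the second half twist brings \<open>y\<close> back to the base tuple and fixes \<open>p\<close>.
\<close>

lemma johnson_arc_commutator: "johnson arc_commutator = t + t ^ 2 - t ^ 3 - t ^ 4"
proof -
  define y where "y = ext_act t s second_twist base"
  note y = arc_displacement[folded y_def]
  note words = second_twist_words[OF order_refl]
  have "burau_act t s second_twist arc_vector = arc_vector"
    by (simp add: burau_act_second_twist theta_pairing)
  then have fixed: "burau_act t s (inv_word second_twist) arc_vector = arc_vector"
    using A.hurwitz_inv_word[OF words, of arc_vector] by simp
  have "ext_act t s arc_commutator base = ext_act t s (inv_word second_twist) (ext_act t s [(3, True)] y)"
    unfolding arc_commutator_def hurwitz_append ext_act_sigma3_base y_def ..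
  also have "\<dots> = shift base (\<lambda>k. (t - t * t * t) * arc_vector k)"
    unfolding ext_act_sigma3[OF y(1,2)] y(3) ext_act_shift burau_act_scale fixed
    unfolding y_def E.hurwitz_inv_word[OF words] ..
  finally have d: "displacement arc_commutator k = (t - t * t * t) * arc_vector k" for k
    unfolding displacement_def by (simp add: snd_snd_shift_base)
  show ?thesis
    unfolding johnson_def d by (simp add: arc_vector_def algebra_simps power2_eq_square power3_eq_cube power4_eq_xxxx)
qed

section \<open>Infinitely many independent classes\<close>

lemma BurE:
  assumes "X \<in> carrier (Bur n)"
  obtains w where "w \<in> Bur_words n" "X = braid_cong n `` {w}"
proof -
  have X: "X \<in> carrier (braid_group n)" "burau n X = 1\<^sub>m n" using assms by (auto simp: Bur_def kernel_def)
  obtain w where w: "w \<in> braid_words n" "X = braid_cong n `` {w}" using X(1) by (rule braid_carrierE)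
  then show ?thesis using that[of w] X(2) burau_class[OF w(1)] by (simp add: Bur_words_def)
qed

lemma BurI: "w \<in> Bur_words n \<Longrightarrow> braid_cong n `` {w} \<in> carrier (Bur n)"
  by (simp add: Bur_words_def Bur_def kernel_def braid_class_carrier burau_class)

text \<open>By \<open>johnson_class\<close> below, \<^const>\<open>johnson\<close> is constant on classes, so \<^const>\<open>the_elem\<close> picks its value.\<close>

definition johnson_class :: "braid_word set \<Rightarrow> laurent" where
  "johnson_class X = the_elem (johnson ` X)"

lemma johnson_class:
  assumes "w \<in> braid_words n" shows "johnson_class (braid_cong n `` {w}) = johnson w"
proof -
  have "johnson v = johnson w" if "v \<in> braid_cong n `` {w}" for v
    using that johnson_cong[of n w v] by (simp add: braid_cong_def)
  moreover have "w \<in> braid_cong n `` {w}" using assms by (simp add: braid_cong_def braid_eq.refl)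
  ultimately have "johnson ` (braid_cong n `` {w}) = {johnson w}" by blast
  then show ?thesis by (simp add: johnson_class_def)
qed

lemma johnson_class_mult:
  assumes "X \<in> carrier (Bur n)" "Y \<in> carrier (Bur n)"
  shows "johnson_class (X \<otimes>\<^bsub>Bur n\<^esub> Y) = johnson_class X + johnson_class Y"
proof -
  obtain v where v: "v \<in> Bur_words n" "X = braid_cong n `` {v}" using assms(1) by (rule BurE)
  obtain w where w: "w \<in> Bur_words n" "Y = braid_cong n `` {w}" using assms(2) by (rule BurE)
  have vw: "v \<in> braid_words n" "w \<in> braid_words n" using v w by (auto simp: Bur_words_def)
  have "X \<otimes>\<^bsub>Bur n\<^esub> Y = braid_cong n `` {v @ w}"
    using braid_class_mult[OF vw] by (simp add: Bur_def v w)
  then show ?thesis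
    using johnson_class[OF vw(1)] johnson_class[OF vw(2)] johnson_class[of "v @ w" n] vw
      johnson_append[OF v(1) w(1)] by (simp add: v w)
qed

definition conjugate :: "nat \<Rightarrow> braid_word" where
  "conjugate m = (conj_sigma3 ^^ m) arc_commutator"

lemma conjugate_Bur: "6 \<le> n \<Longrightarrow> conjugate m \<in> Bur_words n"
  by (induction m) (simp_all add: conjugate_def arc_commutator_Bur conj_sigma3)

lemma johnson_conjugate: "johnson (conjugate m) = (- t) ^ m * johnson arc_commutator"
proof (induction m)
  case (Suc m)
  then show ?case
    using conj_sigma3(2)[OF _ conjugate_Bur[of 6 m]] by (simp add: conjugate_def)
qed (simp add: conjugate_def)

lemma laurent_t_power: "t ^ m = Poly_Mapping.single (int m) 1"
  by (induction m) (simp_all add: laurent_t_def mult_single)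

text \<open>The exponents that occur are \<open>m + 1, \<dots>, m + 4\<close>; the number 4 is the degree of \<open>J(g)\<close>.\<close>

lemma lookup_johnson_conjugate:
  shows "Poly_Mapping.lookup (johnson (conjugate m)) (int m + 4) \<noteq> 0"
    and "m < j \<Longrightarrow> Poly_Mapping.lookup (johnson (conjugate m)) (int j + 4) = 0"
proof -
  have "johnson (conjugate m) = (- 1) ^ m * (t ^ (m + 1) + t ^ (m + 2) - t ^ (m + 3) - t ^ (m + 4))"
    unfolding johnson_conjugate johnson_arc_commutator power_minus[of t]
    by (simp add: algebra_simps power_add power2_eq_square power3_eq_cube power4_eq_xxxx)
  then have "johnson (conjugate m) = (if even m then 1 else - 1)
      * (t ^ (m + 1) + t ^ (m + 2) - t ^ (m + 3) - t ^ (m + 4))" by simp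
  then show "Poly_Mapping.lookup (johnson (conjugate m)) (int m + 4) \<noteq> 0"
    and "m < j \<Longrightarrow> Poly_Mapping.lookup (johnson (conjugate m)) (int j + 4) = 0"
    unfolding laurent_t_power
    by (auto simp: lookup_add lookup_minus lookup_single when_def)
qed

theorem theorem1p3:
  fixes n :: nat
  assumes "n \<ge> 6"
  shows "infinite_rank (H1 (Bur n)) \<and>
    \<not> (\<exists>S. finite S \<and> S \<subseteq> carrier (Bur n) \<and> generate (Bur n) S = carrier (Bur n))"
proof
  define \<psi> where "\<psi> m X = Poly_Mapping.lookup (johnson_class X) (int m + 4)" for m :: nat and X
  define g where "g k = braid_cong n `` {conjugate k}" for k
  have g: "g k \<in> carrier (Bur n)" for k
    unfolding g_def by (rule BurI[OF conjugate_Bur[OF assms]])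
  have add: "\<psi> m (X \<otimes>\<^bsub>Bur n\<^esub> Y) = \<psi> m X + \<psi> m Y"
    if "X \<in> carrier (Bur n)" "Y \<in> carrier (Bur n)" for m X Y
    using johnson_class_mult[OF that] by (simp add: \<psi>_def lookup_add)
  have \<psi>g: "\<psi> m (g k) = Poly_Mapping.lookup (johnson (conjugate k)) (int m + 4)" for m k
    using conjugate_Bur[OF assms, of k] by (simp add: \<psi>_def g_def johnson_class Bur_words_def)
  have diag: "\<psi> m (g m) \<noteq> 0" for m
    unfolding \<psi>g by (rule lookup_johnson_conjugate(1))
  have tri: "\<psi> m (g k) = 0" if "k < m" for m k
    unfolding \<psi>g by (rule lookup_johnson_conjugate(2)[OF that])
  show "infinite_rank (H1 (Bur n))"
    by (rule infinite_rank_H1I[of "Bur n" g \<psi>]) (use group_Bur g add diag tri in auto)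
  show "\<not> (\<exists>S. finite S \<and> S \<subseteq> carrier (Bur n) \<and> generate (Bur n) S = carrier (Bur n))"
  proof (rule not_finitely_generatedI[of "Bur n" \<psi>])
    fix X
    have "{m. \<psi> m X \<noteq> 0} \<subseteq> (\<lambda>m. int m + 4) -` Poly_Mapping.keys (johnson_class X)"
      by (auto simp: \<psi>_def in_keys_iff)
    then show "finite {m. \<psi> m X \<noteq> 0}"
      by (rule finite_subset) (intro finite_vimageI, auto simp: inj_def)
  next
    show "\<exists>X\<in>carrier (Bur n). \<psi> m X \<noteq> 0" for m using g diag by blast
  qed (use group_Bur add in auto)
qed

end
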